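(* For all integers $0\le k\le r$ there is a constant $\tau$ depending only on $k$ such that whenever $b=\binom{c_{k-1}}{k-1}+\dots+\binom{c_1}{1}$ for some integers $c_{k-1}>c_{k-2}>\dots>c_1\ge 0$, we have \[\binom{c_{k-1}}{k}+\dots+\binom{c_1}{2}\;\le\; f(r,k,b)\;\le\;\binom{c_{k-1}}{k}+\dots+\binom{c_1}{2}+\tau.\]
   Context: $\mathbb{N}^{(s)}$ denotes the family of all $s$-element subsets of $\mathbb{N}$. For integers $0\le k\le r$ and $b\ge 0$, $f(r,k,b)$ denotes the maximum of $|\mathcal{A}|$ over all pairs of families $\mathcal{A}\subset\mathbb{N}^{(r)}$, $\mathcal{B}\subset\mathbb{N}^{(r-1)}$ with $|\mathcal{B}|=b$ such that for every $A\in\mathcal{A}$ there exist $k$ distinct sets $B_1,\dots,B_k\in\mathcal{B}$ with $B_i\subset A$ for all $i$. Binomial coefficients $\binom{c}{i}$ with $c<i$ are $0$.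
   Formalization: The formal theorem assumes k ≥ 1: for k = 0 (so b = 0) and r ≥ 1 the condition on the family A is vacuous, so f(r,0,0) is unbounded and the upper bound fails. *)

theory Defs
  imports Main "HOL-Library.Extended_Nat"
begin

definition nsets_nat :: "nat \<Rightarrow> nat set set" where
  "nsets_nat s = {X. finite X \<and> card X = s}"

text \<open>f(r,k,b): the maximum of the size of a family A of r-sets such that, for some family B of
 (r-1)-sets with |B| = b, each member of A contains k distinct members of B. Taken as a supremum
 in the extended naturals (it is infinity when the maximum does not exist).\<close>
definition f_max :: "nat \<Rightarrow> nat \<Rightarrow> nat \<Rightarrow> enat" where
  "f_max r k b = Sup {enat (card \<A>) | \<A> \<B>.
      finite \<A> \<and> \<A> \<subseteq> nsets_nat r \<and> \<B> \<subseteq> nsets_nat (r - 1) \<and> finite \<B> \<and> card \<B> = b \<and>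
      (\<forall>A\<in>\<A>. \<exists>S. S \<subseteq> \<B> \<and> card S = k \<and> (\<forall>X\<in>S. X \<subseteq> A))}"

end

theory Submission
  imports Defs
begin

text \<open>
  Write \<open>k = j + 1\<close>, let \<open>g\<close> be the Kruskal--Katona function of the cascade and let \<open>b\<close> be the
  number of \<open>(r - 1)\<close>-sets. For any set \<open>X\<close>, let \<open>b\<^sub>0\<close> of them contain \<open>X\<close> and \<open>b\<^sub>1\<close> not. An
  \<open>r\<close>-set \<open>A \<supseteq> X\<close> containing some \<open>B\<close> of the second kind is \<open>B \<union> X\<close>, so
  \<open>f(b) \<le> f(b\<^sub>0) + f(b\<^sub>1) + b\<^sub>1\<close>. As \<open>g\<close> is superlinear, \<open>g(b) \<ge> g(b\<^sub>0) + g(b\<^sub>1) + b\<^sub>1\<close> unless \<open>b\<^sub>1\<close> is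
  bounded or \<open>b\<^sub>0 = O(b^((j - 1)/j))\<close>, and induction on \<open>b\<close> applies. Otherwise every vertex is
  either common (missed by boundedly many sets) or rare (in \<open>O(b^((j - 1)/j))\<close> of them), and
  the set \<open>X\<close> of common vertices is contained in all but boundedly many sets. If \<open>|X| \<ge> r - k\<close>,
  the links of an \<open>(r - k)\<close>-subset of \<open>X\<close> form a genuine Kruskal--Katona problem. If \<open>|X| < r - k\<close>
  and \<open>|\<A>| > g(b)\<close>, prune to minimum degree of order \<open>b^(1/j)\<close>; exchanging \<open>j\<close> elements one at a
  time reaches from a fixed \<open>B\<^sub>0\<close> a positive proportion of all sets, each sharing \<open>r - k - |X| > 0\<close>
  rare vertices with \<open>B\<^sub>0\<close>, which is too many.

  The induction is run twice: errors add up in a split, so the first run only yields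
  \<open>f(b) \<le> g(b) + O(b)\<close>; in the second run the gain in \<open>g\<close> absorbs the linear error of the smaller part.
\<close>

section \<open>The Kruskal--Katona theorem\<close>

text \<open>The cascade \<open>c\<^sub>j > \<dots> > c\<^sub>1 \<ge> 0\<close> is encoded by the nondecreasing \<open>e i = c\<^sub>i\<^sub>+\<^sub>1 - i\<close>; this makes Pascal's
  rule hold termwise without side conditions on vanishing binomial coefficients.\<close>

definition casc :: "nat \<Rightarrow> (nat \<Rightarrow> nat) \<Rightarrow> nat" where
  "casc j e = (\<Sum>i<j. (i + e i) choose (i + 1))"

definition casc_up :: "nat \<Rightarrow> (nat \<Rightarrow> nat) \<Rightarrow> nat" where
  "casc_up j e = (\<Sum>i<j. (i + e i) choose (i + 2))"

text \<open>\<open>\<B>\<close> may be any finite family containing the shadow of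
  \<open>\<A>\<close>, so links can serve as \<open>\<B>\<close> directly.\<close>

definition shadow_sys :: "nat \<Rightarrow> nat set set \<Rightarrow> nat set set \<Rightarrow> bool" where
  "shadow_sys j \<A> \<B> \<longleftrightarrow> finite \<A> \<and> finite \<B> \<and>
     (\<forall>A\<in>\<A>. finite A \<and> card A = Suc j \<and> (\<forall>x\<in>A. A - {x} \<in> \<B>))"

section \<open>Compression of set families\<close>

definition swap_in :: "nat \<Rightarrow> nat \<Rightarrow> nat set \<Rightarrow> nat set" where
  "swap_in v x S = insert v (S - {x})"

text \<open>The usual compression: \<open>x\<close> is replaced by \<open>v\<close> unless the
  result is already in the family, which keeps the map injective.\<close>

definition shift_set :: "nat \<Rightarrow> nat \<Rightarrow> nat set set \<Rightarrow> nat set \<Rightarrow> nat set" where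
  "shift_set v x \<F> S = (if x \<in> S \<and> v \<notin> S \<and> swap_in v x S \<notin> \<F> then swap_in v x S else S)"

definition shift_fam :: "nat \<Rightarrow> nat \<Rightarrow> nat set set \<Rightarrow> nat set set" where
  "shift_fam v x \<F> = shift_set v x \<F> ` \<F>"

lemma swap_in_inj:
  assumes "x \<in> S" "v \<notin> S" "x \<in> S'" "v \<notin> S'" "swap_in v x S = swap_in v x S'"
  shows "S = S'"
  using assms unfolding swap_in_def by (metis Diff_insert_absorb insert_Diff insert_iff Diff_iff)

lemma inj_on_shift_set: "inj_on (shift_set v x \<F>) \<F>"
proof (rule inj_onI)
  fix S S' assume "S \<in> \<F>" "S' \<in> \<F>" "shift_set v x \<F> S = shift_set v x \<F> S'"
  then show "S = S'"
    using swap_in_inj[of x S v S'] by (auto simp: shift_set_def split: if_splits)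
qed

lemma card_shift_fam: "card (shift_fam v x \<F>) = card \<F>"
  unfolding shift_fam_def by (rule card_image[OF inj_on_shift_set])

lemma finite_shift_fam: "finite \<F> \<Longrightarrow> finite (shift_fam v x \<F>)"
  unfolding shift_fam_def by simp

lemma swap_in_swap_in:
  assumes "v \<noteq> x" "x \<in> S" "v \<notin> S" shows "swap_in x v (swap_in v x S) = S"
  using assms unfolding swap_in_def by auto

text \<open>Sets pair off under exchanging \<open>x\<close> and \<open>v\<close>. If just one of a
  pair is in \<open>\<F>\<close>, the shifted family contains the one with \<open>v\<close>;
  otherwise nothing changes.\<close>

lemma mem_shift_fam:
  assumes "v \<noteq> x"
  shows "S \<in> shift_fam v x \<F> \<longleftrightarrow>
    (if x \<in> S \<and> v \<notin> S then S \<in> \<F> \<and> swap_in v x S \<in> \<F>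
     else if v \<in> S \<and> x \<notin> S then S \<in> \<F> \<or> swap_in x v S \<in> \<F>
     else S \<in> \<F>)" (is "?L \<longleftrightarrow> ?R")
proof
  assume ?L
  then obtain R where R: "R \<in> \<F>" "S = shift_set v x \<F> R" by (auto simp: shift_fam_def)
  show ?R
  proof (cases "x \<in> R \<and> v \<notin> R \<and> swap_in v x R \<notin> \<F>")
    case True
    then have S: "S = swap_in v x R" using R by (simp add: shift_set_def)
    then have "v \<in> S" "x \<notin> S" using assms by (auto simp: swap_in_def)
    moreover have "swap_in x v S = R" unfolding S using assms True by (intro swap_in_swap_in) simp_all
    ultimately show ?thesis using R by simp
  next
    case False
    then have "S = R" using R by (auto simp: shift_set_def)
    then show ?thesis using R False by auto
  qed
next
  assume R: ?R
  show ?L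
  proof (cases "S \<in> \<F>")
    case True
    then have "shift_set v x \<F> S = S" using R by (auto simp: shift_set_def)
    then show ?thesis using True unfolding shift_fam_def by (intro image_eqI[of S _ S]) simp_all
  next
    case False
    then have S: "v \<in> S" "x \<notin> S" "swap_in x v S \<in> \<F>" using R by (auto split: if_splits)
    have "x \<in> swap_in x v S" "v \<notin> swap_in x v S" using assms by (auto simp: swap_in_def)
    moreover have "swap_in v x (swap_in x v S) = S" using S assms by (intro swap_in_swap_in) simp_all
    ultimately have "shift_set v x \<F> (swap_in x v S) = S" using False by (simp add: shift_set_def)
    then show ?thesis using S unfolding shift_fam_def by (intro image_eqI[of S _ "swap_in x v S"]) simp_all
  qed
qed

lemma card_swap_in:
  assumes "finite S" "x \<in> S" "v \<notin> S" shows "card (swap_in v x S) = card S"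
proof -
  have "card (swap_in v x S) = Suc (card (S - {x}))"
    unfolding swap_in_def using assms by (intro card_insert_disjoint) auto
  then show ?thesis using card_Suc_Diff1[OF assms(1,2)] by simp
qed

text \<open>Compression does not enlarge the shadow: a shifted set with \<open>x\<close> but not
  \<open>v\<close> has both versions in \<open>\<A>\<close>, one with \<open>v\<close> but not
  \<open>x\<close> has at least one, and this passes to the sets \<open>S - {u}\<close>.\<close>

lemma shadow_sys_shift:
  assumes sys: "shadow_sys j \<A> \<B>" and vx: "v \<noteq> x"
  shows "shadow_sys j (shift_fam v x \<A>) (shift_fam v x \<B>)"
proof -
  have sh: "A - {y} \<in> \<B>" if "A \<in> \<A>" "y \<in> A" for A y using sys that by (auto simp: shadow_sys_def)
  have "finite S \<and> card S = Suc j" if "S \<in> shift_fam v x \<A>" for S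
  proof -
    obtain R where R: "R \<in> \<A>" "S = shift_set v x \<A> R" using \<open>S \<in> _\<close> by (auto simp: shift_fam_def)
    have "finite R" "card R = Suc j" using sys R by (auto simp: shadow_sys_def)
    then show ?thesis using R card_swap_in[of R x v]
      by (auto simp: shift_set_def) (simp add: swap_in_def)
  qed
  moreover have "S - {u} \<in> shift_fam v x \<B>" if S: "S \<in> shift_fam v x \<A>" and u: "u \<in> S" for S u
  proof -
    consider (both) "x \<in> S" "v \<in> S" | (none) "x \<notin> S" "v \<notin> S" | (x) "x \<in> S" "v \<notin> S" | (v) "v \<in> S" "x \<notin> S"
      by blast
    then show ?thesis
    proof cases
      case both
      then have A: "S \<in> \<A>" using S by (simp add: mem_shift_fam[OF vx])
      have "swap_in v x (S - {v}) = S - {x}" using both vx by (auto simp: swap_in_def)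
      then show ?thesis using sh[OF A] both u vx by (auto simp: mem_shift_fam[OF vx])
    next
      case none
      then show ?thesis using S sh u by (auto simp: mem_shift_fam[OF vx])
    next
      case x
      then have A: "S \<in> \<A>" "swap_in v x S \<in> \<A>" using S by (auto simp: mem_shift_fam[OF vx])
      have "swap_in v x (S - {u}) = swap_in v x S - {u}" "u \<in> swap_in v x S" if "u \<noteq> x"
        using x u that by (auto simp: swap_in_def)
      then show ?thesis using sh[OF A(1)] sh[OF A(2)] x u by (auto simp: mem_shift_fam[OF vx])
    next
      case v
      then have A: "S \<in> \<A> \<or> swap_in x v S \<in> \<A>" using S by (auto simp: mem_shift_fam[OF vx])
      have 1: "swap_in x v (S - {u}) = swap_in x v S - {u}" "u \<in> swap_in x v S" if "u \<noteq> v"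
        using v u that by (auto simp: swap_in_def)
      \<comment> \<open>Deleting \<open>v\<close> from \<open>S\<close> and \<open>x\<close> from
        its partner gives the same set, so it does not matter which of the two lies in
        \<open>\<A>\<close>.\<close>
      have 2: "swap_in x v S - {x} = S - {v}" "x \<in> swap_in x v S" using v by (auto simp: swap_in_def)
      show ?thesis
      proof (cases "u = v")
        case True
        then have "S - {u} \<in> \<B>" using A 2 sh u by metis
        then show ?thesis using True v by (auto simp: mem_shift_fam[OF vx])
      next
        case False
        then have "S - {u} \<in> \<B> \<or> swap_in x v (S - {u}) \<in> \<B>" using A 1 sh u by metis
        then show ?thesis using v False by (auto simp: mem_shift_fam[OF vx])
      qed
    qed
  qed
  ultimately show ?thesis using sys finite_shift_fam by (simp add: shadow_sys_def)
qed

text \<open>Every shift that changes \<open>\<A>\<close> lowers the number of sets avoiding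
  \<open>v\<close>, so shifting towards \<open>v\<close> terminates.\<close>

lemma shadow_sys_stable_exists:
  assumes "shadow_sys j \<A> \<B>"
  shows "\<exists>\<A>' \<B>'. shadow_sys j \<A>' \<B>' \<and> card \<A>' = card \<A> \<and> card \<B>' = card \<B> \<and>
    (\<forall>S\<in>\<A>'. \<forall>x\<in>S. v \<notin> S \<longrightarrow> swap_in v x S \<in> \<A>')"
  using assms
proof (induction "card {S\<in>\<A>. v \<notin> S}" arbitrary: \<A> \<B> rule: less_induct)
  case less
  show ?case
  proof (cases "\<forall>S\<in>\<A>. \<forall>x\<in>S. v \<notin> S \<longrightarrow> swap_in v x S \<in> \<A>")
    case True
    then show ?thesis using less.prems by blast
  next
    case False
    then obtain S x where S: "S \<in> \<A>" "x \<in> S" "v \<notin> S" "swap_in v x S \<notin> \<A>" by blast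
    then have vx: "v \<noteq> x" by blast
    have "{R \<in> shift_fam v x \<A>. v \<notin> R} \<subseteq> {R\<in>\<A>. v \<notin> R}"
      by (auto simp: mem_shift_fam[OF vx] split: if_splits)
    moreover have "S \<notin> shift_fam v x \<A>" using S by (simp add: mem_shift_fam[OF vx])
    ultimately have "{R \<in> shift_fam v x \<A>. v \<notin> R} \<subset> {R\<in>\<A>. v \<notin> R}" using S by blast
    moreover have "finite \<A>" using less.prems by (simp add: shadow_sys_def)
    ultimately have "card {R \<in> shift_fam v x \<A>. v \<notin> R} < card {R\<in>\<A>. v \<notin> R}"
      by (intro psubset_card_mono) auto
    from less.hyps[OF this shadow_sys_shift[OF less.prems vx]] show ?thesis
      by (simp add: card_shift_fam)
  qed
qed

section \<open>Pascal's rule for cascades\<close>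

lemma choose_pred:
  "(i + n) choose (i + 1) = ((i + (n - 1)) choose (i + 1)) + (if n = 0 then 0 else (i + (n - 1)) choose i)"
  by (cases n) auto

lemma casc_pascal:
  "casc (Suc j) e = casc (Suc j) (\<lambda>i. e i - 1) + casc j (\<lambda>i. e (Suc i)) + (if e 0 = 0 then 0 else 1)"
proof -
  have *: "(if e (Suc i) = 0 then 0 else (Suc i + (e (Suc i) - 1)) choose (Suc i))
      = (i + e (Suc i)) choose (i + 1)" for i
    by (cases "e (Suc i)") auto
  have "casc (Suc j) e = casc (Suc j) (\<lambda>i. e i - 1)
      + (\<Sum>i<Suc j. if e i = 0 then 0 else (i + (e i - 1)) choose i)"
    unfolding casc_def sum.distrib[symmetric] by (intro sum.cong refl choose_pred)
  also have "(\<Sum>i<Suc j. if e i = 0 then 0 else (i + (e i - 1)) choose i)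
     = casc j (\<lambda>i. e (Suc i)) + (if e 0 = 0 then 0 else 1)"
    unfolding casc_def sum.lessThan_Suc_shift * by simp
  finally show ?thesis by simp
qed

lemma casc_up_pascal: "casc_up j e = casc_up j (\<lambda>i. e i - 1) + casc j (\<lambda>i. e i - 1)"
proof -
  have *: "(i + n) choose (i + 2) = ((i + (n - 1)) choose (i + 2)) + ((i + (n - 1)) choose (i + 1))" for i n :: nat
    by (cases n) auto
  show ?thesis unfolding casc_def casc_up_def sum.distrib[symmetric] by (intro sum.cong refl *)
qed

text \<open>Term \<open>i\<close> on the left is term \<open>i + 1\<close> of the decremented
  cascade. In \<open>kruskal_katona\<close> this converts the induction bound for the link.\<close>

lemma casc_up_shift_le: "casc_up j (\<lambda>i. e (Suc i)) \<le> casc (Suc j) (\<lambda>i. e i - 1)"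
proof -
  have "(i + e (Suc i)) choose (i + 2) \<le> (Suc i + (e (Suc i) - 1)) choose (Suc i + 1)" for i
    by (cases "e (Suc i)") auto
  then have "casc_up j (\<lambda>i. e (Suc i)) \<le> (\<Sum>i<j. (Suc i + (e (Suc i) - 1)) choose (Suc i + 1))"
    unfolding casc_up_def by (intro sum_mono) auto
  also have "\<dots> \<le> casc (Suc j) (\<lambda>i. e i - 1)" unfolding casc_def sum.lessThan_Suc_shift by simp
  finally show ?thesis .
qed

lemma card_split_vertex:
  fixes v :: nat
  assumes "finite \<F>"
  shows "card \<F> = card {S. v \<notin> S \<and> insert v S \<in> \<F>} + card {S\<in>\<F>. v \<notin> S}"
    and "finite {S. v \<notin> S \<and> insert v S \<in> \<F>}"
proof -
  have bij: "bij_betw (\<lambda>S. insert v S) {S. v \<notin> S \<and> insert v S \<in> \<F>} {S\<in>\<F>. v \<in> S}"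
    by (rule bij_betw_byWitness[where f' = "\<lambda>S. S - {v}"]) (auto simp: insert_absorb)
  then show "finite {S. v \<notin> S \<and> insert v S \<in> \<F>}" using assms bij_betw_finite by force
  have "card \<F> = card {S\<in>\<F>. v \<in> S} + card {S\<in>\<F>. v \<notin> S}"
    using assms by (subst card_Un_disjoint[symmetric]) (auto intro: arg_cong[where f = card])
  then show "card \<F> = card {S. v \<notin> S \<and> insert v S \<in> \<F>} + card {S\<in>\<F>. v \<notin> S}"
    using bij_betw_same_card[OF bij] by simp
qed

text \<open>Frankl's proof. In a family shifted towards \<open>0\<close>, the sets avoiding \<open>0\<close> have their shadow in the
  link of \<open>0\<close>, so it suffices to bound the size of that link.\<close>

theorem kruskal_katona:
  assumes "mono e" "shadow_sys j \<A> \<B>" "card \<B> \<le> casc j e"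
  shows "card \<A> \<le> casc_up j e"
  using assms
proof (induction j arbitrary: e \<A> \<B>)
  case 0
  have "\<B> = {}" using 0 by (simp add: casc_def shadow_sys_def)
  then have "\<A> = {}" using 0 by (force simp: shadow_sys_def card_Suc_eq)
  then show ?case by simp
next
  case (Suc j)
  note IH = Suc.IH
  from Suc.prems show ?case
  \<comment> \<open>The outer induction handles the link of \<open>0\<close>; this inner one handles
    the sets avoiding \<open>0\<close>, for which the top value \<open>e j\<close> drops by
    one.\<close>
  proof (induction "e j" arbitrary: e \<A> \<B>)
    case 0
    have "e i = 0" if "i \<le> j" for i using monoD[OF 0(2) that] 0 by simp
    then have "casc (Suc j) e = 0" by (simp add: casc_def)
    then have "\<B> = {}" using 0 by (simp add: shadow_sys_def)
    then have "\<A> = {}" using 0 by (force simp: shadow_sys_def card_Suc_eq)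
    then show ?case by simp
  next
    case (Suc t)
    obtain \<A>' \<B>' where sys: "shadow_sys (Suc j) \<A>' \<B>'"
      and cards: "card \<A>' = card \<A>" "card \<B>' = card \<B>"
      and stable: "\<And>S x. S \<in> \<A>' \<Longrightarrow> x \<in> S \<Longrightarrow> 0 \<notin> S \<Longrightarrow> swap_in 0 x S \<in> \<A>'"
      using shadow_sys_stable_exists[OF Suc.prems(2), of 0] by blast
    have fin: "finite \<A>'" "finite \<B>'"
      and sh: "\<And>A y. A \<in> \<A>' \<Longrightarrow> y \<in> A \<Longrightarrow> A - {y} \<in> \<B>'"
      and cA: "\<And>A. A \<in> \<A>' \<Longrightarrow> finite A \<and> card A = Suc (Suc j)"
      using sys by (auto simp: shadow_sys_def)
    define \<A>1 where "\<A>1 = {S. 0 \<notin> S \<and> insert 0 S \<in> \<A>'}"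
    define \<A>0 where "\<A>0 = {S\<in>\<A>'. 0 \<notin> S}"
    define \<B>1 where "\<B>1 = {S. 0 \<notin> S \<and> insert 0 S \<in> \<B>'}"
    define \<B>0 where "\<B>0 = {S\<in>\<B>'. 0 \<notin> S}"
    note sA = card_split_vertex[OF fin(1), of 0, folded \<A>1_def \<A>0_def]
    note sB = card_split_vertex[OF fin(2), of 0, folded \<B>1_def \<B>0_def]
    let ?d = "\<lambda>i. e i - 1" and ?s = "\<lambda>i. e (Suc i)"
    have mono_d: "mono ?d" using Suc.prems(1) by (auto simp: mono_def diff_le_mono)
    have mono_s: "mono ?s" using Suc.prems(1) by (auto simp: mono_def)
    have "\<A>1 \<subseteq> \<B>0"
    proof
      fix S assume "S \<in> \<A>1"
      then have "insert 0 S - {0} \<in> \<B>'" "0 \<notin> S" using sh[of "insert 0 S" 0] by (auto simp: \<A>1_def)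
      then show "S \<in> \<B>0" by (simp add: \<B>0_def)
    qed
    then have le1: "card \<A>1 \<le> card \<B>0" using fin by (intro card_mono) (auto simp: \<B>0_def)
    have sys1: "shadow_sys j \<A>1 \<B>1"
      unfolding shadow_sys_def
    proof (intro conjI ballI)
      fix S assume S: "S \<in> \<A>1"
      then have "finite (insert 0 S)" "card (insert 0 S) = Suc (Suc j)" "0 \<notin> S"
        using cA[of "insert 0 S"] by (auto simp: \<A>1_def)
      then show "finite S" "card S = Suc j" by auto
      fix x assume x: "x \<in> S"
      then have "insert 0 S - {x} \<in> \<B>'" "0 \<notin> S"
        using S sh[of "insert 0 S" x] by (auto simp: \<A>1_def)
      moreover have "x \<noteq> 0" using x \<open>0 \<notin> S\<close> by metis
      ultimately show "S - {x} \<in> \<B>1" by (simp add: \<B>1_def insert_Diff_if)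
    qed (simp_all add: sA(2) sB(2))
    have sys0: "shadow_sys (Suc j) \<A>0 \<A>1"
      unfolding shadow_sys_def
    proof (intro conjI ballI)
      fix S x assume "S \<in> \<A>0" "x \<in> S"
      then show "S - {x} \<in> \<A>1" using stable[of S x] by (auto simp: \<A>0_def \<A>1_def swap_in_def)
    qed (use sA cA fin in \<open>auto simp: \<A>0_def\<close>)
    \<comment> \<open>Either \<open>\<B>1\<close> is small and the outer induction applies, or it
      exceeds \<open>casc j ?s\<close> by at least one. That one pays for the last summand of
      \<open>casc_pascal\<close>, and \<open>\<B>0\<close>, a superset of \<open>\<A>1\<close>, is
      small.\<close>
    have m1: "card \<A>1 \<le> casc (Suc j) ?d"
    proof (cases "card \<B>1 \<le> casc j ?s")
      case True
      then show ?thesis using IH[OF mono_s sys1] casc_up_shift_le[of j e] by linarith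
    next
      case False
      then have "card \<B>0 \<le> casc (Suc j) ?d"
        using sB(1) cards Suc.prems(3) casc_pascal[of j e] by (auto split: if_splits)
      then show ?thesis using le1 by simp
    qed
    have "t = ?d j" using Suc.hyps(2) by simp
    from Suc.hyps(1)[OF this mono_d sys0 m1] have "card \<A>0 \<le> casc_up (Suc j) ?d" .
    then show ?case using m1 sA(1) cards casc_up_pascal[of "Suc j" e] by simp
  qed
qed

section \<open>The Kruskal--Katona function\<close>

text \<open>The extremal example, an initial segment of the colexicographic order: each stage joins
  a new vertex to the preceding family and adds all sets of the right size on smaller vertices. The
  range bound makes that vertex new; the last conjunct is used by
  \<open>kk_add_vertex\<close>.\<close>

lemma casc_family:
  assumes "mono e"
  shows "\<exists>\<A> \<B>. shadow_sys j \<A> \<B> \<and> card \<B> = casc j e \<and> card \<A> = casc_up j e \<and>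
    (\<forall>S\<in>\<A> \<union> \<B>. S \<subseteq> {..<j + e j}) \<and> (\<forall>S\<in>\<B>. card S = j) \<and>
    (\<forall>i. j = Suc i \<longrightarrow> {S. S \<subseteq> {..<i + e i} \<and> card S = Suc i} \<subseteq> \<B>)"
proof (induction j)
  case 0
  show ?case by (intro exI[of _ "{}"]) (auto simp: shadow_sys_def casc_def casc_up_def)
next
  case (Suc j)
  then obtain \<A> \<B> where sys: "shadow_sys j \<A> \<B>" and cB: "card \<B> = casc j e"
    and cA: "card \<A> = casc_up j e" and sub: "\<forall>S\<in>\<A> \<union> \<B>. S \<subseteq> {..<j + e j}"
    and cj: "\<forall>S\<in>\<B>. card S = j" by (elim exE conjE)
  note sub = bspec[OF sub] and cj = bspec[OF cj]
  have fin: "finite \<A>" "finite \<B>" using sys by (auto simp: shadow_sys_def)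
  let ?c = "j + e j"
  let ?K = "\<lambda>i. {S. S \<subseteq> {..<?c} \<and> card S = i}"
  have K: "card (?K i) = ?c choose i" "finite (?K i)" for i
    using n_subsets[of "{..<?c}" i] by auto
  have new: "?c \<notin> S" if "S \<in> \<A> \<union> \<B>" for S using sub[OF that] by auto
  have newK: "?c \<notin> S" if "S \<in> ?K i" for S i using that by auto
  have cardU: "card (?K i \<union> insert ?c ` \<F>) = (?c choose i) + card \<F>"
    if "\<F> \<subseteq> \<A> \<union> \<B>" "finite \<F>" for i \<F>
  proof -
    have "inj_on (insert ?c) \<F>"
      by (rule inj_on_inverseI[where g = "\<lambda>S. S - {?c}"]) (use new that(1) in force)
    moreover have "?K i \<inter> insert ?c ` \<F> = {}" using newK by auto
    ultimately show ?thesis using K that by (simp add: card_Un_disjoint card_image)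
  qed
  have "shadow_sys (Suc j) (?K (Suc (Suc j)) \<union> insert ?c ` \<A>) (?K (Suc j) \<union> insert ?c ` \<B>)"
    unfolding shadow_sys_def
  proof (intro conjI ballI)
    fix S assume S: "S \<in> ?K (Suc (Suc j)) \<union> insert ?c ` \<A>"
    have "finite S \<and> card S = Suc (Suc j) \<and> (\<forall>x\<in>S. S - {x} \<in> ?K (Suc j) \<union> insert ?c ` \<B>)"
      using S
    proof
      assume "S \<in> ?K (Suc (Suc j))"
      moreover from this have "finite S" by (metis (lifting) mem_Collect_eq finite_lessThan finite_subset)
      ultimately show ?thesis by auto
    next
      assume "S \<in> insert ?c ` \<A>"
      then obtain R where R: "R \<in> \<A>" "S = insert ?c R" by blast
      have R': "finite R" "card R = Suc j" "\<And>x. x \<in> R \<Longrightarrow> R - {x} \<in> \<B>" "R \<subseteq> {..<?c}" "?c \<notin> R"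
        using sys R(1) sub[of R] new[of R] by (auto simp: shadow_sys_def)
      have "S - {x} \<in> ?K (Suc j) \<union> insert ?c ` \<B>" if "x \<in> S" for x
      proof (cases "x = ?c")
        case True
        then show ?thesis using R R' by auto
      next
        case False
        then have "x \<in> R" "S - {x} = insert ?c (R - {x})" using that R by auto
        then show ?thesis using R'(3) by auto
      qed
      then show ?thesis using R R' by auto
    qed
    then show "finite S" "card S = Suc (Suc j)"
      and "\<And>x. x \<in> S \<Longrightarrow> S - {x} \<in> ?K (Suc j) \<union> insert ?c ` \<B>" by auto
  qed (use fin K in auto)
  moreover have "card (?K (Suc j) \<union> insert ?c ` \<B>) = casc (Suc j) e"
    using cardU[of \<B> "Suc j"] fin cB by (simp add: casc_def)
  moreover have "card (?K (Suc (Suc j)) \<union> insert ?c ` \<A>) = casc_up (Suc j) e"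
    using cardU[of \<A> "Suc (Suc j)"] fin cA by (simp add: casc_up_def)
  moreover have "S \<subseteq> {..<Suc j + e (Suc j)}"
    if "S \<in> (?K (Suc (Suc j)) \<union> insert ?c ` \<A>) \<union> (?K (Suc j) \<union> insert ?c ` \<B>)" for S
  proof -
    have "S \<subseteq> {..?c}" using that sub by fastforce
    moreover have "e j \<le> e (Suc j)" using assms by (simp add: mono_def)
    ultimately show ?thesis by fastforce
  qed
  moreover have "card S = Suc j" if "S \<in> ?K (Suc j) \<union> insert ?c ` \<B>" for S
  proof -
    have "card (insert ?c R) = Suc j" if "R \<in> \<B>" for R
      using that cj[of R] new[of R] sub[of R] finite_subset[of R "{..<?c}"] by simp
    then show ?thesis using that by auto
  qed
  moreover have "{S. S \<subseteq> {..<i + e i} \<and> card S = Suc i} \<subseteq> ?K (Suc j) \<union> insert ?c ` \<B>" if "Suc j = Suc i" for i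
    using that by blast
  ultimately show ?case by meson
qed

section \<open>Cascade representations\<close>

lemma choose_bracket:
  assumes "0 < (j::nat)"
  obtains c where "c choose j \<le> n" "n < Suc c choose j" "j \<le> Suc c"
proof -
  define P where "P c \<longleftrightarrow> c choose j \<le> n" for c :: nat
  have "P (j - 1)" using assms by (simp add: P_def binomial_eq_0)
  moreover have "c \<le> n + j" if "P c" for c
  proof (rule ccontr)
    assume "\<not> c \<le> n + j"
    have "c choose j \<ge> (n + Suc j) choose j" using \<open>\<not> _\<close> by (intro binomial_right_mono) auto
    moreover have "(n + Suc j) choose j \<ge> n + 1"
    proof -
      obtain i where i: "j = Suc i" using assms by (cases j) auto
      have "(n + Suc i choose Suc i) \<ge> n + 1" for n
      proof (induction n)
        case (Suc n)
        have "(Suc n + Suc i choose Suc i) = (Suc (n + i) choose i) + (n + Suc i choose Suc i)" by simp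
        moreover have "0 < Suc (n + i) choose i" by (rule zero_less_binomial) simp
        ultimately show ?case using Suc by linarith
      qed simp
      from this[of n] show ?thesis using i binomial_right_mono[of "n + Suc i" "n + Suc j" j]
        by (meson add_left_mono le_SucI le_trans order_refl)
    qed
    ultimately show False using that by (simp add: P_def)
  qed
  \<comment> \<open>The largest index with binomial at most \<open>n\<close> exists:
    \<open>j - 1\<close> qualifies, as its binomial vanishes, and \<open>n + j\<close> bounds all
    such indices.\<close>
  ultimately have "P (GREATEST c. P c)" "\<not> P (Suc (GREATEST c. P c))" "j - 1 \<le> (GREATEST c. P c)"
    using GreatestI_nat[of P "j - 1" "n + j"] Greatest_le_nat[of P _ "n + j"] not_less_eq_eq by blast+
  then show ?thesis using that[of "GREATEST c. P c"] by (auto simp: P_def)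
qed

lemma choose_less_imp_less: "a choose j < b choose j \<Longrightarrow> a < (b::nat)"
  by (metis binomial_right_mono not_le)

text \<open>Greedy choice: for the largest \<open>c\<close> with
  \<open>c choose Suc j \<le> n\<close>, Pascal's rule leaves a remainder below
  \<open>c choose j\<close>, which keeps the next entry below \<open>c\<close>.\<close>

lemma casc_exists:
  assumes "0 < j"
  shows "\<exists>e. mono e \<and> casc j e = n"
  using assms
proof (induction j arbitrary: n rule: nat_induct_non_zero)
  case 1
  show ?case by (rule exI[of _ "\<lambda>_. n"]) (simp add: mono_def casc_def)
next
  case (Suc j)
  obtain c where c: "c choose Suc j \<le> n" "n < Suc c choose Suc j" "Suc j \<le> Suc c"
    by (rule choose_bracket[of "Suc j"]) auto
  obtain e where e: "mono e" "casc j e = n - (c choose Suc j)" using Suc.IH by blast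
  obtain i where i: "j = Suc i" using Suc.hyps by (cases j) auto
  have "i + e i choose j \<le> casc j e" by (simp add: casc_def i)
  also have "\<dots> < c choose j" using c e by simp
  finally have "i + e i < c" by (rule choose_less_imp_less)
  then have le: "e i \<le> c - j" using i by simp
  define e' where "e' t = (if t < j then e t else c - j)" for t
  have "e t \<le> c - j" if "t < j" for t using monoD[OF e(1), of t i] that i le by simp
  then have "mono e'" using e(1) by (auto simp: e'_def mono_def)
  moreover have "casc (Suc j) e' = n" using e c by (simp add: casc_def e'_def)
  ultimately show ?case by blast
qed

text \<open>A combinatorial argument: the extremal family of \<open>e\<close> is subject to the
  Kruskal--Katona bound of \<open>e'\<close>.\<close>

lemma casc_up_mono:
  assumes "mono e" "mono e'" "casc j e \<le> casc j e'"
  shows "casc_up j e \<le> casc_up j e'"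
  using casc_family[OF assms(1), of j] kruskal_katona[OF assms(2)] assms(3) by metis

text \<open>Only meaningful for \<open>0 < j\<close>: for \<open>j = 0\<close> no cascade represents a positive \<open>n\<close>.\<close>

definition kk :: "nat \<Rightarrow> nat \<Rightarrow> nat" where
  "kk j n = casc_up j (SOME e. mono e \<and> casc j e = n)"

text \<open>Cascades of equal value are compared in both directions by \<open>casc_up_mono\<close>,
  so the choice made in \<open>kk\<close> does not matter.\<close>

lemma kk_casc:
  assumes "mono e" shows "kk j (casc j e) = casc_up j e"
proof -
  define e' where "e' = (SOME d. mono d \<and> casc j d = casc j e)"
  have "mono e' \<and> casc j e' = casc j e" unfolding e'_def by (rule someI[of _ e]) (simp add: assms)
  then show ?thesis unfolding kk_def e'_def[symmetric]
    using casc_up_mono[of e e' j] casc_up_mono[of e' e j] assms by simp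
qed

lemma kk_upper:
  assumes "0 < j" "shadow_sys j \<A> \<B>" "card \<B> \<le> n"
  shows "card \<A> \<le> kk j n"
  using casc_exists[OF assms(1), of n] kruskal_katona[of _ j \<A> \<B>] assms kk_casc[of _ j] by metis

lemma kk_mono:
  assumes "0 < j" "m \<le> n" shows "kk j m \<le> kk j n"
  using casc_exists[OF assms(1), of n] casc_exists[OF assms(1), of m] casc_up_mono kk_casc assms by metis

lemma kk_choose:
  assumes "0 < j" shows "kk j (c choose j) = c choose Suc j"
proof (cases "j \<le> Suc c")
  case True
  obtain i where i: "j = Suc i" using assms by (cases j) auto
  \<comment> \<open>Zero entries contribute \<open>t choose (t + 1) = 0\<close>, leaving only the
    top term.\<close>
  let ?e = "\<lambda>t. if t < i then 0 else c - i"
  have "mono ?e" by (auto simp: mono_def)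
  moreover have "casc j ?e = c choose j" "casc_up j ?e = c choose Suc j"
    using True by (simp_all add: i casc_def casc_up_def)
  ultimately show ?thesis using kk_casc by metis
next
  case False
  have "mono (\<lambda>_::nat. 0::nat)" by (simp add: mono_def)
  from kk_casc[OF this, of j] show ?thesis using False by (simp add: casc_def casc_up_def binomial_eq_0)
qed

text \<open>By Pascal's rule the lower terms cannot fill the gap to the next binomial, so the value
  determines the top entry.\<close>

lemma casc_less:
  assumes "mono e" shows "casc (Suc i) e < Suc (i + e i) choose Suc i"
proof (induction i)
  case 0
  then show ?case by (simp add: casc_def)
next
  case (Suc i)
  note Suc
  also have "Suc (i + e i) choose Suc i \<le> (Suc i + e (Suc i)) choose Suc i"
    using monoD[OF assms, of i "Suc i"] by (intro binomial_right_mono) auto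
  finally show ?case by (simp add: casc_def)
qed

text \<open>Join a new vertex to all \<open>(j - 1)\<close>-subsets of \<open>{..<c}\<close> in the extremal family of size \<open>m\<close>,
  which contains all \<open>j\<close>-subsets of \<open>{..<c}\<close>.\<close>
lemma kk_add_vertex:
  assumes "0 < j" "c choose j \<le> m"
  shows "kk j m + (c choose j) \<le> kk j (m + (c choose (j - 1)))"
proof -
  obtain i where i: "j = Suc i" using assms(1) by (cases j) auto
  obtain e where e: "mono e" "casc j e = m" using casc_exists assms(1) by blast
  obtain \<A> \<B> where sys: "shadow_sys j \<A> \<B>" and cB: "card \<B> = casc j e"
    and cA: "card \<A> = casc_up j e" and sub: "\<forall>S\<in>\<A> \<union> \<B>. S \<subseteq> {..<j + e j}"
    and full: "\<forall>i. j = Suc i \<longrightarrow> {S. S \<subseteq> {..<i + e i} \<and> card S = Suc i} \<subseteq> \<B>"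
    using casc_family[OF e(1), of j] by (elim exE conjE)
  have cB: "card \<B> = m" and cA: "card \<A> = kk j m" using cA cB e kk_casc[OF e(1), of j] by simp_all
  have full: "{S. S \<subseteq> {..<i + e i} \<and> card S = j} \<subseteq> \<B>" using full i by simp
  let ?K = "\<lambda>i. {S. S \<subseteq> {..<c} \<and> card S = i}"
  have K: "card (?K i) = c choose i" "finite (?K i)" for i
    using n_subsets[of "{..<c}" i] by auto
  have Ksub: "?K j \<subseteq> \<B>"
  proof -
    have "c choose j < Suc (i + e i) choose j"
      using casc_less[OF e(1), of i] e(2) assms(2) i by simp
    then have "c < Suc (i + e i)" by (rule choose_less_imp_less)
    then have sub': "{..<c} \<subseteq> {..<i + e i}" by auto
    show ?thesis
    proof
      fix S assume "S \<in> ?K j"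
      then have "S \<subseteq> {..<i + e i}" "card S = j" using subset_trans[OF _ sub', of S] by auto
      then show "S \<in> \<B>" using full by (simp add: subset_iff)
    qed
  qed
  define w where "w = j + e j + c"
  have new: "w \<notin> S" if "S \<in> \<A> \<union> \<B>" for S using bspec[OF sub that] by (auto simp: w_def)
  have newK: "w \<notin> S" if "S \<in> ?K i" for S i using that by (auto simp: w_def)
  have fin: "finite \<A>" "finite \<B>" using sys by (auto simp: shadow_sys_def)
  have cardU: "card (\<F> \<union> insert w ` ?K i) = card \<F> + (c choose i)"
    if "\<F> \<subseteq> \<A> \<union> \<B>" "finite \<F>" for i \<F>
  proof -
    have "inj_on (insert w) (?K i)"
      by (rule inj_on_inverseI[where g = "\<lambda>S. S - {w}"]) (use newK in force)
    moreover have "\<F> \<inter> insert w ` ?K i = {}" using new that(1) by blast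
    ultimately show ?thesis using K that by (simp add: card_Un_disjoint card_image)
  qed
  have "shadow_sys j (\<A> \<union> insert w ` ?K j) (\<B> \<union> insert w ` ?K i)"
    unfolding shadow_sys_def
  proof (intro conjI ballI)
    fix S assume S: "S \<in> \<A> \<union> insert w ` ?K j"
    have "finite S \<and> card S = Suc j \<and> (\<forall>x\<in>S. S - {x} \<in> \<B> \<union> insert w ` ?K i)"
      using S
    proof
      assume "S \<in> \<A>"
      then show ?thesis using sys by (auto simp: shadow_sys_def)
    next
      assume "S \<in> insert w ` ?K j"
      then obtain R where R: "R \<in> ?K j" "S = insert w R" by blast
      have R': "finite R" "w \<notin> R" using R newK[of R j] finite_subset[of R "{..<c}"] by auto
      have "S - {x} \<in> \<B> \<union> insert w ` ?K i" if "x \<in> S" for x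
      proof (cases "x = w")
        case True
        then show ?thesis using R R' Ksub by auto
      next
        case False
        then have "x \<in> R" "S - {x} = insert w (R - {x})" using that R by auto
        moreover have "R - {x} \<in> ?K i" using R R' \<open>x \<in> R\<close> i by auto
        ultimately show ?thesis by auto
      qed
      then show ?thesis using R R' by auto
    qed
    then show "finite S" "card S = Suc j"
      and "\<And>x. x \<in> S \<Longrightarrow> S - {x} \<in> \<B> \<union> insert w ` ?K i" by auto
  qed (use fin K in auto)
  from kk_upper[OF assms(1) this order_refl] show ?thesis
    using cardU[of \<A> j] cardU[of \<B> i] fin cA cB i by simp
qed

lemma kk_add_vertices:
  assumes "0 < j" "c choose j \<le> m"
  shows "kk j m + p * (c choose j) \<le> kk j (m + p * (c choose (j - 1)))"
proof (induction p)
  case (Suc p)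
  then show ?case using kk_add_vertex[OF assms(1), of c "m + p * (c choose (j - 1))"] assms(2)
    by (simp add: algebra_simps)
qed simp

section \<open>Superlinear growth\<close>

lemma kk_le_linear:
  assumes "0 < j" "n < Suc c choose j"
  shows "Suc j * kk j n \<le> Suc c * n"
proof -
  obtain a where a: "a choose j \<le> n" "n < Suc a choose j" by (rule choose_bracket[OF assms(1)]) auto
  have "a choose j < Suc c choose j" using a assms by simp
  then have "a < Suc c" by (rule choose_less_imp_less)
  \<comment> \<open>Rounding \<open>n\<close> up to a binomial gives \<open>kk\<close> in closed
    form; absorption then brings back \<open>a choose j\<close>, which is at most
    \<open>n\<close>.\<close>
  have "Suc j * kk j n \<le> Suc j * kk j (Suc a choose j)" using a by (intro mult_le_mono2 kk_mono assms(1)) simp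
  also have "\<dots> = Suc j * (Suc a choose Suc j)" by (simp add: kk_choose[OF assms(1)])
  also have "\<dots> = Suc a * (a choose j)" by (rule Suc_times_binomial)
  also have "\<dots> \<le> Suc c * n" using a \<open>a < Suc c\<close> by (intro mult_le_mono) auto
  finally show ?thesis .
qed

lemma choose_pred_mult:
  assumes "0 < j" shows "(c choose (j - 1)) * (c - (j - 1)) = j * (c choose j)"
proof -
  obtain i where i: "j = Suc i" using assms by (cases j) auto
  have "c * ((c - 1) choose i) = Suc i * (c choose Suc i)" using binomial_absorption[of i c] by simp
  then show ?thesis using binomial_absorb_comp[of c i] i by (simp add: mult.commute)
qed

text \<open>The inequality of \<open>kk_gain\<close> after multiplying by \<open>(j + 1) * d\<close>
  and cancelling \<open>Q\<close>. The surplus \<open>p * d\<close> of the right over the leading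
  term \<open>p * j * d\<close> absorbs the rest.\<close>

lemma kk_gain_arith:
  fixes p j d l :: nat
  assumes "4 * j + 2 \<le> p" "4 * (l + 2) * (j + 1)^2 \<le> d"
  shows "(p + 1) * j * (d + j) + (j + 1) * (d + j) + l * (p + 1) * (j + 1) * j \<le> p * (j + 1) * d"
proof -
  have "2 * (l + 2) * (j + 1)^2 * p * 2 \<le> p * d" using mult_le_mono2[OF assms(2), of p] by (simp add: algebra_simps)
  moreover have "(4 * j + 2) * d \<le> p * d" using assms(1) by (rule mult_le_mono1)
  moreover have "j * j \<le> (j+1)^2" "j \<le> (j+1)^2" by (simp_all add: power2_eq_square)
  moreover have "p * (j * j) \<le> p * (j+1)^2" "p * (l * (j * j + j)) \<le> p * (l * (j+1)^2)"
    by (intro mult_le_mono2, simp add: power2_eq_square)+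
  moreover have "1 * (j+1)^2 \<le> p * (j+1)^2" "1 * (l * (j * j + j)) \<le> p * (l * (j * j + j))"
    using assms(1) by (intro mult_le_mono1; simp)+
  ultimately show ?thesis by (simp add: algebra_simps power2_eq_square)
qed

text \<open>Adding \<open>p = n div q\<close> vertices to the extremal family of size
  \<open>m\<close> gains \<open>p * Q\<close>, about \<open>n * d / j\<close>, while
  \<open>kk j n\<close> is at most \<open>n * Suc c / (j + 1)\<close>. As \<open>d\<close> is close
  to \<open>c\<close>, the difference of \<open>1 / j\<close> and \<open>1 / (j + 1)\<close> pays
  for the other terms.\<close>

lemma kk_gain:
  assumes j: "0 < j" and m: "c choose j \<le> m" and n: "n < Suc c choose j"
    and n': "(4 * j + 2) * (c choose (j - 1)) \<le> n" and c: "4 * (l + 2) * (j + 1)^2 + j \<le> c"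
  shows "kk j m + kk j n + (Suc c choose j) + l * n \<le> kk j (m + n)"
proof -
  define q where "q = c choose (j - 1)"
  define Q where "Q = c choose j"
  define d where "d = c - (j - 1)"
  define p where "p = n div q"
  have q0: "q > 0" unfolding q_def using c by simp
  have Q0: "Q > 0" unfolding Q_def using c by simp
  have d: "4 * (l + 2) * (j + 1)^2 \<le> d" "Suc c = d + j" using c j by (auto simp: d_def)
  then have d0: "d > 0" by (auto simp: power2_eq_square)
  have qd: "q * d = j * Q" using choose_pred_mult[OF j] by (simp add: q_def Q_def d_def)
  have p: "4 * j + 2 \<le> p" unfolding p_def using n' q0 by (simp add: q_def less_eq_div_iff_mult_less_eq)
  have pn: "p * q \<le> n" "n \<le> (p + 1) * q"
    using q0 unfolding p_def by (simp_all) (metis add.commute dividend_less_times_div less_imp_le mult_Suc mult.commute)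
  have S: "Suc c choose j = Q + q" unfolding Q_def q_def using j by (cases j) auto
  have "(j + 1) * d * (kk j n + (Q + q) + l * n)
      = d * (Suc j * kk j n) + (j + 1) * (d * Q + q * d) + l * (j + 1) * (d * n)" by (simp add: algebra_simps)
  also have "\<dots> \<le> d * (Suc c * ((p + 1) * q)) + (j + 1) * (d * Q + q * d) + l * (j + 1) * (d * ((p + 1) * q))"
  proof -
    have "Suc j * kk j n \<le> Suc c * n" by (rule kk_le_linear[OF j n])
    also have "\<dots> \<le> Suc c * ((p + 1) * q)" using pn by (intro mult_le_mono2)
    finally show ?thesis using pn by (intro add_mono mult_le_mono2) auto
  qed
  also have "\<dots> = (p + 1) * (d + j) * (q * d) + (j + 1) * (d * Q + q * d) + l * (j + 1) * ((p + 1) * (q * d))"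
    by (simp add: d algebra_simps)
  also have "\<dots> = Q * ((p + 1) * j * (d + j) + (j + 1) * (d + j) + l * (p + 1) * (j + 1) * j)"
    unfolding qd by (simp add: algebra_simps)
  also have "\<dots> \<le> Q * (p * (j + 1) * d)" by (intro mult_le_mono2 kk_gain_arith p d)
  also have "\<dots> = (j + 1) * d * (p * Q)" by (simp add: algebra_simps)
  finally have "kk j n + (Q + q) + l * n \<le> p * Q" using d0 by (simp only: mult_le_cancel1) simp
  moreover have "kk j m + p * Q \<le> kk j (m + p * q)"
    unfolding Q_def q_def by (rule kk_add_vertices[OF j m])
  moreover have "kk j (m + p * q) \<le> kk j (m + n)" using pn by (intro kk_mono j) simp
  ultimately show ?thesis using S by linarith
qed

section \<open>Partial shadow systems\<close>

definition part_sys :: "nat \<Rightarrow> nat \<Rightarrow> nat set set \<Rightarrow> nat set set \<Rightarrow> bool" where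
  "part_sys r k \<A> \<B> \<longleftrightarrow> finite \<A> \<and> finite \<B> \<and> \<A> \<subseteq> nsets_nat r \<and> \<B> \<subseteq> nsets_nat (r - 1) \<and>
     (\<forall>S\<in>\<A>. k \<le> card {T\<in>\<B>. T \<subseteq> S})"

lemma part_sysD:
  assumes "part_sys r k \<A> \<B>"
  shows "finite \<A>" "finite \<B>" "\<And>S. S \<in> \<A> \<Longrightarrow> finite S" "\<And>S. S \<in> \<A> \<Longrightarrow> card S = r"
    "\<And>T. T \<in> \<B> \<Longrightarrow> finite T" "\<And>T. T \<in> \<B> \<Longrightarrow> card T = r - 1"
    "\<And>S. S \<in> \<A> \<Longrightarrow> k \<le> card {T\<in>\<B>. T \<subseteq> S}"
  using assms by (auto simp: part_sys_def nsets_nat_def)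

lemma part_sys_restrict:
  assumes "part_sys r k \<A> \<B>" "\<A>' \<subseteq> \<A>" "\<B>' \<subseteq> \<B>"
    "\<And>S T. S \<in> \<A>' \<Longrightarrow> T \<in> \<B> \<Longrightarrow> T \<subseteq> S \<Longrightarrow> T \<in> \<B>'"
  shows "part_sys r k \<A>' \<B>'"
proof -
  have "k \<le> card {T\<in>\<B>'. T \<subseteq> S}" if S: "S \<in> \<A>'" for S
  proof -
    have "{T\<in>\<B>. T \<subseteq> S} = {T\<in>\<B>'. T \<subseteq> S}" using assms(3,4) S by blast
    then show ?thesis using part_sysD(7)[OF assms(1), of S] assms(2) S by auto
  qed
  then show ?thesis using assms(1-3) finite_subset unfolding part_sys_def by blast
qed

lemma part_sys_member:
  assumes "part_sys r k \<A> \<B>" "S \<in> \<A>" "T \<in> \<B>" "T \<subseteq> S" "0 < r"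
  obtains u where "u \<in> S" "u \<notin> T" "T = S - {u}" "S = insert u T"
proof -
  have "card (S - T) = 1"
    using part_sysD(3-6)[OF assms(1)] assms by (simp add: card_Diff_subset)
  then obtain u where "S - T = {u}" by (auto simp: card_1_singleton_iff)
  then show ?thesis using that[of u] assms(4) by blast
qed

lemma part_sys_union:
  assumes "part_sys r k \<A> \<B>" "S \<in> \<A>" "T \<in> \<B>" "T \<subseteq> S" "X \<subseteq> S" "\<not> X \<subseteq> T"
  shows "S = T \<union> X"
proof -
  have fin: "finite S" "finite T" "card S = r" "card T = r - 1" using part_sysD[OF assms(1)] assms by auto
  have "T \<subset> T \<union> X" using assms by blast
  moreover have sub: "T \<union> X \<subseteq> S" using assms by blast
  ultimately have "card T < card (T \<union> X)" using fin by (meson finite_subset psubset_card_mono)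
  then have "card S \<le> card (T \<union> X)" using fin by simp
  then show ?thesis using card_seteq[OF fin(1) sub] by simp
qed

text \<open>Two distinct members inside \<open>S\<close> have union \<open>S\<close>. This crude
  bound, uniform in \<open>r\<close>, handles \<open>\<B>\<close> of bounded size.\<close>

lemma part_sys_card_le_square:
  assumes "part_sys r k \<A> \<B>" "2 \<le> k"
  shows "card \<A> \<le> card \<B> * card \<B>"
proof -
  note D = part_sysD[OF assms(1)]
  have "\<A> \<subseteq> (\<lambda>(T, T'). T \<union> T') ` (\<B> \<times> \<B>)"
  proof
    fix S assume S: "S \<in> \<A>"
    have "Suc 0 < card {T\<in>\<B>. T \<subseteq> S}" using D(7)[OF S] assms(2) by simp
    then have "\<not> (\<forall>T\<in>{T\<in>\<B>. T \<subseteq> S}. \<forall>T'\<in>{T\<in>\<B>. T \<subseteq> S}. T = T')"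
      using card_le_Suc0_iff_eq[of "{T\<in>\<B>. T \<subseteq> S}"] D(2) by simp
    then obtain T T' where T: "T \<in> \<B>" "T \<subseteq> S" "T' \<in> \<B>" "T' \<subseteq> S" "T \<noteq> T'" by blast
    have "\<not> T' \<subseteq> T" using T D(5,6) by (metis card_subset_eq)
    then have "S = T \<union> T'" using part_sys_union[OF assms(1) S] T by blast
    then show "S \<in> (\<lambda>(T, T'). T \<union> T') ` (\<B> \<times> \<B>)" using T by auto
  qed
  then have "card \<A> \<le> card ((\<lambda>(T, T'). T \<union> T') ` (\<B> \<times> \<B>))" using D by (intro card_mono) auto
  also have "\<dots> \<le> card (\<B> \<times> \<B>)" using D by (intro card_image_le) auto
  finally show ?thesis by (simp add: card_cartesian_product)
qed

text \<open>A set in neither \<open>\<A>0\<close> nor \<open>\<A>1\<close> is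
  \<open>T \<union> X\<close> with \<open>T\<close> in \<open>\<B>1\<close>; these account for the
  last summand of the third claim.\<close>

lemma part_sys_split:
  fixes X :: "nat set"
  assumes "part_sys r k \<A> \<B>"
  defines "\<B>0 \<equiv> {T\<in>\<B>. X \<subseteq> T}" and "\<B>1 \<equiv> {T\<in>\<B>. \<not> X \<subseteq> T}"
    and "\<A>0 \<equiv> {S\<in>\<A>. X \<subseteq> S \<and> (\<forall>T\<in>\<B>. T \<subseteq> S \<longrightarrow> X \<subseteq> T)}" and "\<A>1 \<equiv> {S\<in>\<A>. \<not> X \<subseteq> S}"
  shows "part_sys r k \<A>0 \<B>0" "part_sys r k \<A>1 \<B>1"
    "card \<A> \<le> card \<A>0 + card \<A>1 + card \<B>1" "card \<B> = card \<B>0 + card \<B>1"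
proof -
  note D = part_sysD[OF assms(1)]
  show "part_sys r k \<A>0 \<B>0"
    by (rule part_sys_restrict[OF assms(1)]) (auto simp: \<A>0_def \<B>0_def)
  show "part_sys r k \<A>1 \<B>1"
    by (rule part_sys_restrict[OF assms(1)]) (auto simp: \<A>1_def \<B>1_def)
  have "\<A> \<subseteq> \<A>0 \<union> \<A>1 \<union> (\<lambda>T. T \<union> X) ` \<B>1"
  proof
    fix S assume S: "S \<in> \<A>"
    show "S \<in> \<A>0 \<union> \<A>1 \<union> (\<lambda>T. T \<union> X) ` \<B>1"
    proof (cases "S \<in> \<A>0 \<union> \<A>1")
      case False
      then obtain T where T: "T \<in> \<B>" "T \<subseteq> S" "\<not> X \<subseteq> T" "X \<subseteq> S" using S by (auto simp: \<A>0_def \<A>1_def)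
      then have "S = T \<union> X" using part_sys_union[OF assms(1) S] by blast
      then show ?thesis using T by (auto simp: \<B>1_def)
    qed simp
  qed
  then have "card \<A> \<le> card (\<A>0 \<union> \<A>1 \<union> (\<lambda>T. T \<union> X) ` \<B>1)"
    using D by (intro card_mono) (auto simp: \<A>0_def \<A>1_def \<B>1_def)
  also have "\<dots> \<le> card \<A>0 + card \<A>1 + card ((\<lambda>T. T \<union> X) ` \<B>1)"
    by (meson add_right_mono card_Un_le le_trans)
  also have "\<dots> \<le> card \<A>0 + card \<A>1 + card \<B>1" using D by (auto intro: card_image_le simp: \<B>1_def)
  finally show "card \<A> \<le> card \<A>0 + card \<A>1 + card \<B>1" .
  show "card \<B> = card \<B>0 + card \<B>1"
    unfolding \<B>0_def \<B>1_def using D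
    by (subst card_Un_disjoint[symmetric]) (auto intro: arg_cong[where f = card])
qed

text \<open>Discarding a \<open>T\<close> of degree at most \<open>d\<close> and all sets above it
  costs one member of \<open>\<B>\<close> and at most \<open>d\<close> of \<open>\<A>\<close>, so
  the last hypothesis survives.\<close>

lemma part_sys_prune:
  assumes "part_sys r k \<A> \<B>" "0 < k" "d * card \<B> < card \<A>"
  shows "\<exists>\<A>' \<B>'. \<A>' \<subseteq> \<A> \<and> \<B>' \<subseteq> \<B> \<and> part_sys r k \<A>' \<B>' \<and> \<B>' \<noteq> {} \<and>
    (\<forall>T\<in>\<B>'. d < card {S\<in>\<A>'. T \<subseteq> S})"
  using assms
proof (induction "card \<B>" arbitrary: \<A> \<B> rule: less_induct)
  case less
  note D = part_sysD[OF less.prems(1)]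
  show ?case
  proof (cases "\<forall>T\<in>\<B>. d < card {S\<in>\<A>. T \<subseteq> S}")
    case True
    have "\<A> \<noteq> {}" using less.prems by auto
    then obtain S where "S \<in> \<A>" by blast
    then have "\<B> \<noteq> {}" using D(7)[of S] less.prems(2) by auto
    then show ?thesis using True less.prems by blast
  next
    case False
    then obtain T where T: "T \<in> \<B>" "card {S\<in>\<A>. T \<subseteq> S} \<le> d" by (auto simp: not_less)
    let ?A = "{S\<in>\<A>. \<not> T \<subseteq> S}" and ?B = "\<B> - {T}"
    have sys: "part_sys r k ?A ?B" by (rule part_sys_restrict[OF less.prems(1)]) auto
    have "card \<A> = card {S\<in>\<A>. T \<subseteq> S} + card ?A"
      using D by (subst card_Un_disjoint[symmetric]) (auto intro: arg_cong[where f = card])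
    moreover have cB: "card \<B> = Suc (card ?B)" using T D by (simp add: card_Suc_Diff1 del: card_Diff_insert card_Diff_singleton)
    ultimately have "d * card ?B < card ?A" using less.prems(3) T(2) by simp
    from less.hyps[OF _ sys less.prems(2) this] cB
    obtain \<A>' \<B>' where "\<A>' \<subseteq> ?A" "\<B>' \<subseteq> ?B" "part_sys r k \<A>' \<B>'" "\<B>' \<noteq> {}"
      "\<forall>T\<in>\<B>'. d < card {S\<in>\<A>'. T \<subseteq> S}" by auto
    then show ?thesis by (intro exI[of _ \<A>'] exI[of _ \<B>']) auto
  qed
qed

text \<open>A member of \<open>\<B>\<close> inside \<open>S\<close> is \<open>S - {u}\<close> with
  \<open>u\<close> outside \<open>X\<close>. Only \<open>j + 1\<close> such \<open>u\<close> exist,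
  so all these sets lie in \<open>\<B>\<close>, and removing \<open>X\<close> leaves a genuine
  shadow system.\<close>

lemma part_sys_link_bound:
  assumes sys: "part_sys r (Suc j) \<A> \<B>" and j: "0 < j" "Suc j \<le> r"
    and X: "finite X" "card X = r - Suc j" "\<And>T. T \<in> \<B> \<Longrightarrow> X \<subseteq> T"
  shows "card \<A> \<le> kk j (card \<B>)"
proof -
  note D = part_sysD[OF sys]
  have r: "0 < r" using j by simp
  have XS: "X \<subseteq> S" if "S \<in> \<A>" for S
  proof -
    have "{T\<in>\<B>. T \<subseteq> S} \<noteq> {}" using D(7)[OF that] by (metis card.empty not_less_eq_eq zero_le)
    then show ?thesis using X(3) by blast
  qed
  have all: "S - {u} \<in> \<B>" if S: "S \<in> \<A>" and u: "u \<in> S - X" for S u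
  proof -
    have cS: "card (S - X) = Suc j" using D(3,4)[OF S] XS[OF S] X j by (simp add: card_Diff_subset)
    have sub: "{T\<in>\<B>. T \<subseteq> S} \<subseteq> (\<lambda>u. S - {u}) ` (S - X)"
    proof
      fix T assume T: "T \<in> {T\<in>\<B>. T \<subseteq> S}"
      then have "T \<in> \<B>" "T \<subseteq> S" by simp_all
      then obtain u where "u \<in> S" "u \<notin> T" "T = S - {u}"
        by (rule part_sys_member[OF sys S _ _ r])
      then show "T \<in> (\<lambda>u. S - {u}) ` (S - X)" using X(3)[of T] T by blast
    qed
    have "card ((\<lambda>u. S - {u}) ` (S - X)) \<le> Suc j" using cS card_image_le[of "S - X"] D(3)[OF S] by (metis finite_Diff)
    then have "{T\<in>\<B>. T \<subseteq> S} = (\<lambda>u. S - {u}) ` (S - X)"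
      using D(3,7)[OF S] by (intro card_seteq sub) auto
    then show ?thesis using u by blast
  qed
  have "shadow_sys j ((\<lambda>S. S - X) ` \<A>) ((\<lambda>T. T - X) ` \<B>)"
    unfolding shadow_sys_def
  proof (intro conjI ballI)
    fix R assume "R \<in> (\<lambda>S. S - X) ` \<A>"
    then obtain S where S: "S \<in> \<A>" "R = S - X" by blast
    then show "finite R" "card R = Suc j" using D(3,4)[of S] XS[of S] X j by (simp_all add: card_Diff_subset)
    fix x assume "x \<in> R"
    then have "S - {x} \<in> \<B>" "R - {x} = (S - {x}) - X" using all S by auto
    then show "R - {x} \<in> (\<lambda>T. T - X) ` \<B>" by blast
  qed (use D in auto)
  moreover have "card ((\<lambda>T. T - X) ` \<B>) \<le> card \<B>" using D by (intro card_image_le)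
  ultimately have "card ((\<lambda>S. S - X) ` \<A>) \<le> kk j (card \<B>)" by (rule kk_upper[OF j(1)])
  moreover have "inj_on (\<lambda>S. S - X) \<A>"
    by (rule inj_on_inverseI[where g = "\<lambda>S. S \<union> X"]) (use XS in auto)
  ultimately show ?thesis by (simp add: card_image)
qed

section \<open>Exchanging elements of a fixed member\<close>

lemma card_Diff_sym:
  assumes "finite A" "finite B" "card A = card B" shows "card (A - B) = card (B - A)"
proof -
  have "card A = card (A \<inter> B) + card (A - B)" "card B = card (B \<inter> A) + card (B - A)"
    using assms card_Int_Diff by blast+
  then show ?thesis using assms by (simp add: Int_commute)
qed

text \<open>Add an element outside \<open>B0\<close> (at least \<open>d - i\<close> choices), then remove one of \<open>B0\<close>: the resulting
  \<open>r\<close>-set has only \<open>i + 1 \<le> j\<close> elements outside \<open>B0\<close> but contains \<open>j + 1\<close> members of \<open>\<B>\<close>.\<close>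

lemma part_sys_step:
  assumes sys: "part_sys r (Suc j) \<A> \<B>" and r: "0 < r" and B0: "B0 \<in> \<B>" and i: "i < j"
    and deg: "\<And>T. T \<in> \<B> \<Longrightarrow> d \<le> card {S\<in>\<A>. T \<subseteq> S}"
  defines "L \<equiv> \<lambda>i. {T\<in>\<B>. card (B0 - T) = i}"
  shows "card (L i) * (d - i) \<le> card (L (Suc i)) * (Suc i)^2"
proof -
  note D = part_sysD[OF sys]
  \<comment> \<open>\<open>T'\<close> arises from \<open>T\<close> by adding \<open>y\<close>
    outside \<open>B0\<close> and removing \<open>u\<close> in \<open>B0\<close>. The pairs in this
    relation are counted from both sides.\<close>
  define R where "R T T' \<longleftrightarrow> (\<exists>y\<in>T' - B0. \<exists>u\<in>B0 - T'. T = insert u (T' - {y}))" for T T' :: "nat set"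
  have finL: "finite (L i)" for i using D by (simp add: L_def)
  have cardD: "card (T - B0) = card (B0 - T)" if "T \<in> \<B>" for T
    using D(5,6) that B0 by (intro card_Diff_sym) auto
  have up: "card {T\<in>L i. R T T'} \<le> (Suc i)^2" if T': "T' \<in> L (Suc i)" for T'
  proof -
    have T'B: "T' \<in> \<B>" "card (B0 - T') = Suc i" using T' by (auto simp: L_def)
    have fin: "finite ((T' - B0) \<times> (B0 - T'))" using D(5) T'B B0 by simp
    have "{T\<in>L i. R T T'} \<subseteq> (\<lambda>(y, u). insert u (T' - {y})) ` ((T' - B0) \<times> (B0 - T'))"
      by (force simp: R_def)
    then have "card {T\<in>L i. R T T'} \<le> card ((\<lambda>(y, u). insert u (T' - {y})) ` ((T' - B0) \<times> (B0 - T')))"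
      using fin by (intro card_mono) auto
    also have "\<dots> \<le> card ((T' - B0) \<times> (B0 - T'))" using fin by (rule card_image_le)
    also have "\<dots> = (Suc i)^2" using cardD T'B by (simp add: card_cartesian_product power2_eq_square)
    finally show ?thesis .
  qed
  have low: "d - i \<le> card {T'\<in>L (Suc i). R T T'}" if T: "T \<in> L i" for T
  proof -
    have TB: "T \<in> \<B>" "card (B0 - T) = i" using T by (auto simp: L_def)
    have finT: "finite T" "finite B0" using D(5) TB B0 by auto
    let ?N = "{S\<in>\<A>. T \<subseteq> S}" and ?Z = "(\<lambda>y. insert y T) ` (B0 - T)"
    \<comment> \<open>At most \<open>i\<close> sets extend \<open>T\<close> by an element of
      \<open>B0\<close>; \<open>Gd\<close> keeps the others.\<close>
    define Gd where "Gd = ?N - ?Z"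
    have "card ?Z \<le> i" using card_image_le[of "B0 - T" "\<lambda>y. insert y T"] TB finT by simp
    then have cG: "d - i \<le> card Gd"
      using deg[OF TB(1)] diff_card_le_card_Diff[of ?Z ?N] finT unfolding Gd_def by simp
    have "\<exists>T'. T' \<in> L (Suc i) \<and> R T T' \<and> S = T \<union> T'" if S: "S \<in> Gd" for S
    proof -
      have SA: "S \<in> \<A>" "T \<subseteq> S" using S by (auto simp: Gd_def)
      obtain y where y: "y \<in> S" "y \<notin> T" "T = S - {y}" "S = insert y T"
        by (rule part_sys_member[OF sys SA(1) TB(1) SA(2) r])
      have yB: "y \<notin> B0"
      proof
        assume "y \<in> B0"
        then have "S \<in> ?Z" using y(2,4) by (intro image_eqI[of _ _ y]) simp_all
        then show False using S by (simp add: Gd_def)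
      qed
      have cSB: "card (S - B0) = Suc i"
      proof -
        have "S - B0 = insert y (T - B0)" using y yB by blast
        then show ?thesis using y(2) finT cardD[OF TB(1)] TB(2) by simp
      qed
      have "\<not> {T'\<in>\<B>. T' \<subseteq> S} \<subseteq> (\<lambda>u. S - {u}) ` (S - B0)"
      proof
        assume "{T'\<in>\<B>. T' \<subseteq> S} \<subseteq> (\<lambda>u. S - {u}) ` (S - B0)"
        then have "card {T'\<in>\<B>. T' \<subseteq> S} \<le> card ((\<lambda>u. S - {u}) ` (S - B0))"
          using D(3)[OF SA(1)] by (intro card_mono) auto
        also have "\<dots> \<le> Suc i" using card_image_le[of "S - B0" "\<lambda>u. S - {u}"] D(3)[OF SA(1)] cSB by simp
        finally show False using D(7)[OF SA(1)] i by simp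
      qed
      then obtain T' where T': "T' \<in> \<B>" "T' \<subseteq> S" "T' \<notin> (\<lambda>u. S - {u}) ` (S - B0)" by blast
      obtain u where u: "u \<in> S" "u \<notin> T'" "T' = S - {u}"
        by (rule part_sys_member[OF sys SA(1) T'(1,2) r])
      have uB: "u \<in> B0" using u T'(3) by blast
      have uy: "u \<noteq> y" using uB yB by blast
      have "B0 - T' = insert u (B0 - T)" using u y uB yB by blast
      moreover have "u \<notin> B0 - T" using u uy y by blast
      ultimately have "card (B0 - T') = Suc i" using TB finT by simp
      then have "T' \<in> L (Suc i)" using T' by (simp add: L_def)
      moreover have "y \<in> T' - B0" "u \<in> B0 - T'" "T = insert u (T' - {y})" using u y uB yB uy by blast+
      then have "R T T'" unfolding R_def by blast
      moreover have "S = T \<union> T'" using u y uy by blast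
      ultimately show ?thesis by blast
    qed
    then obtain h where h: "\<And>S. S \<in> Gd \<Longrightarrow> h S \<in> L (Suc i) \<and> R T (h S) \<and> S = T \<union> h S" by metis
    then have "inj_on h Gd" by (intro inj_on_inverseI[where g = "\<lambda>S. T \<union> S"]) metis
    moreover have "h ` Gd \<subseteq> {T'\<in>L (Suc i). R T T'}" using h by blast
    ultimately have "card Gd \<le> card {T'\<in>L (Suc i). R T T'}" using finL by (intro card_inj_on_le) auto
    then show ?thesis using cG by simp
  qed
  have "card (L i) * (d - i) = (\<Sum>T\<in>L i. d - i)" by simp
  also have "\<dots> \<le> (\<Sum>T\<in>L i. card {T'\<in>L (Suc i). R T T'})" by (intro sum_mono low)
  also have "\<dots> = (\<Sum>T'\<in>L (Suc i). card {T\<in>L i. R T T'})"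
    by (rule sum_multicount_gen) (simp_all add: finL)
  also have "\<dots> \<le> (\<Sum>T'\<in>L (Suc i). (Suc i)^2)" by (intro sum_mono up)
  also have "\<dots> = card (L (Suc i)) * (Suc i)^2" by simp
  finally show ?thesis .
qed

text \<open>Iterates \<open>part_sys_step\<close> from \<open>B0\<close> itself; each factor
  \<open>d - i\<close> is weakened to \<open>d - j\<close>, and the squares multiply up to
  \<open>(fact i)^2\<close>.\<close>

lemma part_sys_many_far:
  assumes sys: "part_sys r (Suc j) \<A> \<B>" and r: "0 < r" and B0: "B0 \<in> \<B>"
    and deg: "\<And>T. T \<in> \<B> \<Longrightarrow> d \<le> card {S\<in>\<A>. T \<subseteq> S}" and i: "i \<le> j"
  shows "(d - j) ^ i \<le> card {T\<in>\<B>. card (B0 - T) = i} * (fact i)^2"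
  using i
proof (induction i)
  case 0
  have "B0 \<in> {T\<in>\<B>. card (B0 - T) = 0}" using B0 by simp
  then have "0 < card {T\<in>\<B>. card (B0 - T) = 0}" using part_sysD(2)[OF sys] by (auto simp: card_gt_0_iff)
  then show ?case by simp
next
  case (Suc i)
  let ?L = "\<lambda>i. card {T\<in>\<B>. card (B0 - T) = i}"
  have "(d - j) ^ Suc i \<le> (d - i) * (?L i * (fact i)^2)"
    unfolding power_Suc using Suc by (intro mult_le_mono) auto
  also have "\<dots> = (?L i * (d - i)) * (fact i)^2" by (simp add: algebra_simps)
  also have "\<dots> \<le> (?L (Suc i) * (Suc i)^2) * (fact i)^2"
    using part_sys_step[OF sys r B0 _ deg, of i] Suc.prems by (intro mult_le_mono1) auto
  also have "\<dots> = ?L (Suc i) * (fact (Suc i))^2" by (simp only: fact_Suc power_mult_distrib of_nat_id mult.assoc)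
  finally show ?case .
qed

section \<open>Splitting gains and minimum degree\<close>

text \<open>The superadditivity needed to recurse on a split, where \<open>n\<close> counts the
  members not containing the splitting set. The surplus \<open>l * min m n\<close> is to absorb a
  linear error in the smaller part.\<close>

definition gain_split :: "nat \<Rightarrow> nat \<Rightarrow> nat \<Rightarrow> nat \<Rightarrow> bool" where
  "gain_split j l m n \<longleftrightarrow> kk j m + kk j n + n + l * min m n \<le> kk j (m + n)"

text \<open>For positive \<open>j\<close> and \<open>c\<close> at least this large, the bound on
  \<open>c\<close> in \<open>kk_gain\<close> holds and
  \<open>(4 * j + 2) * (c choose (j - 1)) \<le> c choose j\<close>.\<close>

definition gain_base :: "nat \<Rightarrow> nat \<Rightarrow> nat" where
  "gain_base j l = 4 * (l + 2) * (j + 1)^2 + j + j * (4 * j + 2)"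

lemma gain_split_second_small:
  assumes j: "0 < j" and n: "gain_base j l choose j \<le> n" "n \<le> m"
  shows "gain_split j l m n"
proof -
  obtain c where c: "c choose j \<le> n" "n < Suc c choose j" by (rule choose_bracket[OF j]) auto
  have "gain_base j l choose j < Suc c choose j" using n c by simp
  then have c1: "gain_base j l < Suc c" by (rule choose_less_imp_less)
  have "j * ((4 * j + 2) * (c choose (j - 1))) = (c choose (j - 1)) * (j * (4 * j + 2))"
    by (simp only: mult_ac)
  also have "\<dots> \<le> (c choose (j - 1)) * (c - (j - 1))"
    using c1 by (intro mult_le_mono2) (simp add: gain_base_def)
  also have "\<dots> = j * (c choose j)" by (rule choose_pred_mult[OF j])
  finally have "(4 * j + 2) * (c choose (j - 1)) \<le> c choose j" using j by simp
  then have "kk j m + kk j n + (Suc c choose j) + l * n \<le> kk j (m + n)"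
    using c n c1 by (intro kk_gain[OF j]) (auto simp: gain_base_def)
  then show ?thesis using c n by (simp add: gain_split_def min_absorb2)
qed

text \<open>Now \<open>n\<close> is the larger part and enters \<open>kk_gain\<close> first; the
  summand \<open>Suc a choose j\<close> there exceeds \<open>n\<close> and pays for the term
  \<open>n\<close> of \<open>gain_split\<close>. The smaller part only has to reach a multiple of
  \<open>c choose (j - 1)\<close>.\<close>

lemma gain_split_first_small:
  assumes j: "0 < j" and m: "m \<le> n" "n < Suc c choose j" "gain_base j l choose j \<le> n"
    and m': "(4 * j + 2) * (c choose (j - 1)) \<le> m"
  shows "gain_split j l m n"
proof -
  obtain a where a: "a choose j \<le> n" "n < Suc a choose j" by (rule choose_bracket[OF j]) auto
  have "gain_base j l choose j < Suc a choose j" using m a by simp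
  then have a1: "gain_base j l < Suc a" by (rule choose_less_imp_less)
  have "a choose j < Suc c choose j" using a m by simp
  then have "a < Suc c" by (rule choose_less_imp_less)
  then have "(4 * j + 2) * (a choose (j - 1)) \<le> (4 * j + 2) * (c choose (j - 1))"
    by (intro mult_le_mono2 binomial_right_mono) simp
  then have "kk j n + kk j m + (Suc a choose j) + l * m \<le> kk j (n + m)"
    using a m m' a1 by (intro kk_gain[OF j]) (auto simp: gain_base_def)
  then show ?thesis using a m by (simp add: gain_split_def min_absorb1 add.commute)
qed

text \<open>Counts pairs \<open>(v, T)\<close> with \<open>card (B0 - T) = j\<close> and
  \<open>v\<close> in \<open>B0 \<inter> T\<close> outside \<open>X\<close>: each \<open>T\<close>
  offers \<open>s > 0\<close> such vertices, each vertex lies in at most \<open>D\<close> sets.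
  \<open>part_sys_many_far\<close> bounds the number of these \<open>T\<close> from below.\<close>

lemma part_sys_min_degree_bound:
  assumes sys: "part_sys r (Suc j) \<A> \<B>" and ne: "\<B> \<noteq> {}"
    and deg: "\<And>T. T \<in> \<B> \<Longrightarrow> d \<le> card {S\<in>\<A>. T \<subseteq> S}"
    and X: "finite X" "\<And>T. T \<in> \<B> \<Longrightarrow> X \<subseteq> T" "card X + Suc j < r"
    and rare: "\<And>v. v \<notin> X \<Longrightarrow> card {T\<in>\<B>. v \<in> T} \<le> D"
  shows "(d - j) ^ j \<le> (j + 1) * D * (fact j)^2"
proof -
  note F = part_sysD[OF sys]
  obtain B0 where B0: "B0 \<in> \<B>" using ne by blast
  define L where "L = {T\<in>\<B>. card (B0 - T) = j}"
  define s where "s = r - Suc j - card X"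
  have s: "0 < s" using X by (simp add: s_def)
  have finL: "finite L" using F by (simp add: L_def)
  have c0: "card (B0 - X) = s + j" using F(5,6)[OF B0] X B0 by (simp add: card_Diff_subset s_def)
  have cT: "card {v\<in>B0 - X. v \<in> T} = s" if "T \<in> L" for T
  proof -
    have T: "T \<in> \<B>" "card (B0 - T) = j" using that by (auto simp: L_def)
    have "{v\<in>B0 - X. v \<in> T} = (B0 - X) - (B0 - T)" by blast
    moreover have "B0 - T \<subseteq> B0 - X" using X(2)[OF T(1)] by blast
    ultimately show ?thesis using c0 T F(5)[OF B0] by (simp add: card_Diff_subset)
  qed
  have "s * card L = (\<Sum>T\<in>L. card {v\<in>B0 - X. v \<in> T})" using cT by simp
  also have "\<dots> = (\<Sum>v\<in>B0 - X. card {T\<in>L. v \<in> T})"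
    by (rule sum_multicount_gen) (use finL F(5)[OF B0] in auto)
  also have "\<dots> \<le> (\<Sum>v\<in>B0 - X. D)"
  proof (rule sum_mono)
    fix v assume "v \<in> B0 - X"
    then have "card {T\<in>\<B>. v \<in> T} \<le> D" using rare by blast
    moreover have "card {T\<in>L. v \<in> T} \<le> card {T\<in>\<B>. v \<in> T}" using F by (intro card_mono) (auto simp: L_def)
    ultimately show "card {T\<in>L. v \<in> T} \<le> D" by simp
  qed
  also have "\<dots> = (s + j) * D" using c0 by simp
  \<comment> \<open>Since \<open>s \<ge> 1\<close>, the factor \<open>s\<close> can be cancelled,
    which makes the bound independent of \<open>r\<close>.\<close>
  also have "\<dots> \<le> (s * (j + 1)) * D" using s by (intro mult_le_mono1) (cases s, auto)
  finally have "card L \<le> (j + 1) * D" using s by (simp add: mult.assoc del: One_nat_def add_Suc_right)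
  moreover have "(d - j) ^ j \<le> card L * (fact j)^2"
    unfolding L_def by (rule part_sys_many_far[OF sys _ B0 deg]) (use X in auto)
  ultimately show ?thesis by (meson le_trans mult_le_mono1)
qed

text \<open>\<open>d\<close> has order \<open>c\<close>: small enough that \<open>d * b\<close> is
  at most half of \<open>c choose Suc j\<close>, large enough that its \<open>j\<close>-th power
  beats a multiple of \<open>c^(j - 1)\<close>.\<close>

lemma degree_counts:
  assumes j: "0 < j" and c: "j + 4 * (j + 1) * (N * N + N + 1) + 2 * j + 8 * j * (j + 1)
      + (8 * (j + 1)) ^ j * ((j + 1) * (4 * j + 2) * (fact j)^2) + 1 \<le> c" and b: "b < Suc c choose j"
  defines "d \<equiv> (c - j) div (4 * (j + 1))"
  shows "d * b + N * N + N < c choose Suc j"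
    and "(j + 1) * ((4 * j + 2) * (c choose (j - 1))) * (fact j)^2 < (Suc d - j) ^ j"
proof -
  define Q where "Q = c choose j"
  define q where "q = c choose (j - 1)"
  have Q0: "0 < Q" unfolding Q_def using c by simp
  have qd: "q * (c - (j - 1)) = j * Q" using choose_pred_mult[OF j] by (simp add: q_def Q_def)
  have "q * j \<le> q * (c - (j - 1))" using c by (intro mult_le_mono2) simp
  then have "j * q \<le> j * Q" unfolding qd by (simp only: mult.commute)
  then have "q \<le> Q" using j by simp
  moreover have "Suc c choose j = Q + q" unfolding Q_def q_def using j by (cases j) auto
  ultimately have b2: "b \<le> 2 * Q" using b by simp
  have d4: "4 * (j + 1) * d \<le> c - j" unfolding d_def by (rule times_div_less_eq_dividend)
  have "(j + 1) * (4 * d * Q) \<le> (c - j) * Q" using mult_le_mono1[OF d4, of Q] by (simp add: algebra_simps)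
  also have "\<dots> = (j + 1) * (c choose Suc j)"
    using choose_pred_mult[of "Suc j" c] by (simp add: Q_def mult.commute)
  finally have C: "4 * d * Q \<le> c choose Suc j" by (simp only: mult_le_cancel1)
  have "N * N + N + 1 \<le> d" unfolding d_def
    using c by (subst less_eq_div_iff_mult_less_eq) (auto simp: algebra_simps)
  moreover have "d \<le> d * Q" using Q0 by simp
  ultimately have "N * N + N < d * Q" by linarith
  moreover have "d * b \<le> 2 * (d * Q)" using mult_le_mono2[OF b2, of d] by simp
  ultimately show "d * b + N * N + N < c choose Suc j" using C unfolding mult.assoc by linarith
  show "(j + 1) * ((4 * j + 2) * (c choose (j - 1))) * (fact j)^2 < (Suc d - j) ^ j"
  proof (rule ccontr)
    define E :: nat where "E = (j + 1) * (4 * j + 2) * (fact j)^2"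
    assume "\<not> ?thesis"
    then have "(Suc d - j) ^ j \<le> E * q" by (simp add: E_def q_def algebra_simps)
    also have "q \<le> c ^ (j - 1)" unfolding q_def using c by (intro binomial_le_pow) simp
    finally have 1: "(Suc d - j) ^ j \<le> E * c ^ (j - 1)" by simp
    have "c - j < 4 * (j + 1) * Suc d" unfolding d_def using dividend_less_times_div[of "4 * (j + 1)" "c - j"] by simp
    then have "c \<le> 8 * (j + 1) * (Suc d - j)"
      using c by (simp add: diff_mult_distrib2 algebra_simps)
    then have "c ^ j \<le> (8 * (j + 1) * (Suc d - j)) ^ j" by (rule power_mono) simp
    also have "\<dots> = (8 * (j + 1)) ^ j * (Suc d - j) ^ j" by (rule power_mult_distrib)
    also have "\<dots> \<le> (8 * (j + 1)) ^ j * (E * c ^ (j - 1))" by (intro mult_le_mono2 1)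
    finally have "c * c ^ (j - 1) \<le> (8 * (j + 1)) ^ j * E * c ^ (j - 1)"
      using j by (simp add: power_eq_if mult.assoc)
    moreover have "0 < c ^ (j - 1)" using c by simp
    ultimately have "c \<le> (8 * (j + 1)) ^ j * E" by auto
    then show False using c by (simp add: E_def)
  qed
qed

section \<open>Reduction to the Kruskal--Katona theorem\<close>

text \<open>\<open>X\<close> collects the vertices missed by fewer than \<open>N\<close> members.
  For any other vertex the members containing it are the smaller part, and
  \<open>gain_split_first_small\<close> would give a gain if there were many of them.\<close>

lemma part_sys_dichotomy:
  fixes \<B> :: "nat set set"
  assumes j: "0 < j" and N: "N = gain_base j l choose j"
    and fin: "finite \<B>" "\<And>T. T \<in> \<B> \<Longrightarrow> finite T" and big: "4 * N \<le> card \<B>" and c: "card \<B> < Suc c choose j"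
    and no: "\<And>X. {T\<in>\<B>. X \<subseteq> T} \<noteq> {} \<Longrightarrow> {T\<in>\<B>. \<not> X \<subseteq> T} \<noteq> {} \<Longrightarrow>
      \<not> gain_split j l (card {T\<in>\<B>. X \<subseteq> T}) (card {T\<in>\<B>. \<not> X \<subseteq> T})"
  shows "\<exists>X. finite X \<and> (\<forall>Y. Y \<subseteq> X \<longrightarrow> card {T\<in>\<B>. \<not> Y \<subseteq> T} < N) \<and>
    (\<forall>v. v \<notin> X \<longrightarrow> card {T\<in>\<B>. v \<in> T} \<le> (4 * j + 2) * (c choose (j - 1)))"
proof -
  define b0 where "b0 X = card {T\<in>\<B>. X \<subseteq> T}" for X
  define b1 where "b1 X = card {T\<in>\<B>. \<not> X \<subseteq> T}" for X
  have sum: "card \<B> = b0 X + b1 X" for X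
    unfolding b0_def b1_def using fin
    by (subst card_Un_disjoint[symmetric]) (auto intro: arg_cong[where f = card])
  have N0: "0 < N" unfolding N by (simp add: gain_base_def)
  have no': "\<not> gain_split j l (b0 X) (b1 X)" if "0 < b0 X" "0 < b1 X" for X
    using no[of X] that unfolding b0_def b1_def by fastforce
  have small: "b1 X < N" if "b1 X \<le> b0 X" for X
  proof (rule ccontr)
    assume "\<not> b1 X < N"
    then show False using no'[of X] N0 that gain_split_second_small[OF j, of l "b1 X" "b0 X"] N by simp
  qed
  define X where "X = {v. b1 {v} < N}"
  have "X \<subseteq> \<Union>\<B>"
  proof
    fix v assume "v \<in> X"
    then have "0 < b0 {v}" using sum[of "{v}"] big N0 by (simp add: X_def)
    then have "{T\<in>\<B>. {v} \<subseteq> T} \<noteq> {}" unfolding b0_def by (metis card.empty less_irrefl)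
    then show "v \<in> \<Union>\<B>" by blast
  qed
  then have finX: "finite X" using fin by (meson finite_Union finite_subset)
  have sub: "b1 Y < N" if "Y \<subseteq> X" for Y
  proof -
    have "finite Y" using that finX finite_subset by blast
    then show ?thesis using that
    proof (induction Y)
      case empty
      then show ?case using N0 by (simp add: b1_def)
    next
      case (insert v Y)
      have "{T\<in>\<B>. \<not> insert v Y \<subseteq> T} \<subseteq> {T\<in>\<B>. \<not> {v} \<subseteq> T} \<union> {T\<in>\<B>. \<not> Y \<subseteq> T}" by blast
      then have "b1 (insert v Y) \<le> card ({T\<in>\<B>. \<not> {v} \<subseteq> T} \<union> {T\<in>\<B>. \<not> Y \<subseteq> T})"
        unfolding b1_def using fin by (intro card_mono) auto
      also have "\<dots> \<le> b1 {v} + b1 Y" unfolding b1_def by (rule card_Un_le)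
      \<comment> \<open>The union bound gives only \<open>2 * N\<close>, but this is at most half of
        \<open>card \<B>\<close>, so \<open>small\<close> brings it back below \<open>N\<close>.
        Hence the bound does not grow with \<open>card Y\<close>.\<close>
      finally have "b1 (insert v Y) \<le> 2 * N" using insert by (simp add: X_def)
      then show ?case using small[of "insert v Y"] sum[of "insert v Y"] big by simp
    qed
  qed
  have rare: "card {T\<in>\<B>. v \<in> T} \<le> (4 * j + 2) * (c choose (j - 1))" if "v \<notin> X" for v
  proof (rule ccontr)
    assume "\<not> ?thesis"
    then have lt: "(4 * j + 2) * (c choose (j - 1)) < b0 {v}" by (simp add: b0_def)
    have "\<not> b1 {v} \<le> b0 {v}" using small[of "{v}"] that by (auto simp: X_def)
    then have "b0 {v} < b1 {v}" by simp
    moreover from this have "N \<le> b1 {v}" using sum[of "{v}"] big by simp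
    moreover have "b1 {v} < Suc c choose j" using c sum[of "{v}"] by simp
    ultimately have "gain_split j l (b0 {v}) (b1 {v})"
      using lt N by (intro gain_split_first_small[OF j]) auto
    then show False using no'[of "{v}"] lt \<open>b0 {v} < b1 {v}\<close> by simp
  qed
  show ?thesis using finX sub[unfolded b1_def] rare by blast
qed

text \<open>The outcomes are the bound itself, a split with gain fit for induction, or the bound up
  to a remainder small enough for \<open>part_sys_card_le_square\<close>.\<close>

definition reducible :: "nat \<Rightarrow> nat \<Rightarrow> nat \<Rightarrow> nat \<Rightarrow> nat set set \<Rightarrow> nat set set \<Rightarrow> bool" where
  "reducible j l N r \<A> \<B> \<longleftrightarrow>
    card \<A> \<le> kk j (card \<B>) \<or>
    (\<exists>\<A>0 \<A>1 \<B>0 \<B>1. part_sys r (Suc j) \<A>0 \<B>0 \<and> part_sys r (Suc j) \<A>1 \<B>1 \<and>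
       card \<B> = card \<B>0 + card \<B>1 \<and> 0 < card \<B>0 \<and> 0 < card \<B>1 \<and>
       card \<A> \<le> card \<A>0 + card \<A>1 + card \<B>1 \<and> gain_split j l (card \<B>0) (card \<B>1)) \<or>
    (\<exists>\<A>1 \<B>1. part_sys r (Suc j) \<A>1 \<B>1 \<and> card \<B>1 < N \<and> card \<B>1 \<le> card \<B> \<and>
       card \<A> \<le> kk j (card \<B>) + card \<A>1 + card \<B>1)"

text \<open>The thresholds are chosen before \<open>r\<close>, which is what makes the final
  constant independent of \<open>r\<close>.\<close>

lemma part_sys_reducible:
  assumes j: "0 < j"
  shows "\<exists>M N. \<forall>r \<A> \<B>. Suc j \<le> r \<longrightarrow> part_sys r (Suc j) \<A> \<B> \<longrightarrow> M \<le> card \<B> \<longrightarrow>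
    reducible j l N r \<A> \<B>"
proof -
  define N where "N = gain_base j l choose j"
  \<comment> \<open>\<open>c0\<close> is the threshold of \<open>degree_counts\<close>.
    \<open>M\<close> pushes the bracketing index of \<open>card \<B>\<close> up to \<open>c0\<close>
    and provides the \<open>4 * N\<close> of \<open>part_sys_dichotomy\<close>.\<close>
  define c0 :: nat where "c0 = j + 4 * (j + 1) * (N * N + N + 1) + 2 * j + 8 * j * (j + 1)
      + (8 * (j + 1)) ^ j * ((j + 1) * (4 * j + 2) * (fact j)^2) + 1"
  define M where "M = (c0 choose j) + 4 * N"
  show ?thesis
  proof (rule exI[of _ M], rule exI[of _ N], intro allI impI)
    fix r \<A> \<B> assume r: "Suc j \<le> r" and sys: "part_sys r (Suc j) \<A> \<B>" and M: "M \<le> card \<B>"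
    note D = part_sysD[OF sys]
    let ?B0 = "\<lambda>X. {T\<in>\<B>. X \<subseteq> T}" and ?B1 = "\<lambda>X. {T\<in>\<B>. \<not> X \<subseteq> T}"
    let ?A0 = "\<lambda>X. {S\<in>\<A>. X \<subseteq> S \<and> (\<forall>T\<in>\<B>. T \<subseteq> S \<longrightarrow> X \<subseteq> T)}" and ?A1 = "\<lambda>X. {S\<in>\<A>. \<not> X \<subseteq> S}"
    note sp = part_sys_split[OF sys]
    let ?P1 = "card \<A> \<le> kk j (card \<B>)"
    let ?P2 = "\<exists>\<A>0 \<A>1 \<B>0 \<B>1. part_sys r (Suc j) \<A>0 \<B>0 \<and> part_sys r (Suc j) \<A>1 \<B>1 \<and>
       card \<B> = card \<B>0 + card \<B>1 \<and> 0 < card \<B>0 \<and> 0 < card \<B>1 \<and>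
       card \<A> \<le> card \<A>0 + card \<A>1 + card \<B>1 \<and> gain_split j l (card \<B>0) (card \<B>1)"
    let ?P3 = "\<exists>\<A>1 \<B>1. part_sys r (Suc j) \<A>1 \<B>1 \<and> card \<B>1 < N \<and> card \<B>1 \<le> card \<B> \<and>
       card \<A> \<le> kk j (card \<B>) + card \<A>1 + card \<B>1"
    obtain c where c: "c choose j \<le> card \<B>" "card \<B> < Suc c choose j" by (rule choose_bracket[OF j]) auto
    have "c0 choose j < Suc c choose j" using c M by (simp add: M_def)
    then have c0: "c0 \<le> c" using choose_less_imp_less by fastforce
    show "reducible j l N r \<A> \<B>"
    proof (cases "\<exists>X. ?B0 X \<noteq> {} \<and> ?B1 X \<noteq> {} \<and> gain_split j l (card (?B0 X)) (card (?B1 X))")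
      case True
      then obtain X where X: "?B0 X \<noteq> {}" "?B1 X \<noteq> {}" "gain_split j l (card (?B0 X)) (card (?B1 X))" by blast
      have "0 < card (?B0 X)" "0 < card (?B1 X)" using X D(2) by (simp_all add: card_gt_0_iff)
      then have ?P2 using sp[of X] X(3) by blast
      then show ?thesis unfolding reducible_def by blast
    next
      case False
      then have no: "\<not> gain_split j l (card (?B0 X)) (card (?B1 X))" if "?B0 X \<noteq> {}" "?B1 X \<noteq> {}" for X
        using that by blast
      have big: "4 * N \<le> card \<B>" using M by (simp add: M_def)
      obtain X where X: "finite X" "\<And>Y. Y \<subseteq> X \<Longrightarrow> card (?B1 Y) < N"
        "\<And>v. v \<notin> X \<Longrightarrow> card {T\<in>\<B>. v \<in> T} \<le> (4 * j + 2) * (c choose (j - 1))"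
        using part_sys_dichotomy[OF j N_def D(2) D(5) big c(2) no] by blast
      show ?thesis
      proof (cases "r - Suc j \<le> card X")
        case True
        then obtain Y where Y: "Y \<subseteq> X" "card Y = r - Suc j" by (meson obtain_subset_with_card_n)
        have "card (?A0 Y) \<le> kk j (card (?B0 Y))"
          by (rule part_sys_link_bound[OF sp(1) j r _ Y(2)]) (use finite_subset[OF Y(1) X(1)] in auto)
        also have "\<dots> \<le> kk j (card \<B>)" using sp(4)[of Y] by (intro kk_mono j) simp
        finally have "card \<A> \<le> kk j (card \<B>) + card (?A1 Y) + card (?B1 Y)" using sp(3)[of Y] by linarith
        moreover have "card (?B1 Y) \<le> card \<B>" using sp(4)[of Y] by simp
        ultimately have ?P3 using sp(2)[of Y] X(2)[OF Y(1)] by blast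
        then show ?thesis unfolding reducible_def by blast
      next
        case False
        have ?P1
        proof (rule ccontr)
          assume "\<not> ?P1"
          then have "kk j (c choose j) < card \<A>" using kk_mono[OF j c(1)] by simp
          then have A: "c choose Suc j < card \<A>" by (simp add: kk_choose[OF j])
          define d where "d = (c - j) div (4 * (j + 1))"
          note counts = degree_counts[OF j c0[unfolded c0_def] c(2), folded d_def]
          have b1: "card (?B1 X) < N" using X(2) by blast
          have "card (?A1 X) \<le> card (?B1 X) * card (?B1 X)"
            using j by (intro part_sys_card_le_square[OF sp(2)]) simp
          also have "\<dots> \<le> N * N" using b1 by (intro mult_le_mono) auto
          finally have "card \<A> \<le> card (?A0 X) + N * N + N" using sp(3)[of X] b1 by linarith
          \<comment> \<open>The sets outside \<open>?A0 X\<close> number at most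
            \<open>N * N + N\<close>, which \<open>counts(1)\<close> allows for, so the rest is
            dense enough to prune.\<close>
          then have "d * card \<B> < card (?A0 X)" using A counts(1) by linarith
          moreover have "d * card (?B0 X) \<le> d * card \<B>" using sp(4)[of X] by simp
          ultimately have "d * card (?B0 X) < card (?A0 X)" by linarith
          from part_sys_prune[OF sp(1) _ this] obtain \<A>' \<B>' where
            sub: "\<B>' \<subseteq> ?B0 X" and sys': "part_sys r (Suc j) \<A>' \<B>'" and ne: "\<B>' \<noteq> {}"
            and deg: "\<forall>T\<in>\<B>'. d < card {S\<in>\<A>'. T \<subseteq> S}" by auto
          have "(Suc d - j) ^ j \<le> (j + 1) * ((4 * j + 2) * (c choose (j - 1))) * (fact j)^2"
          proof (rule part_sys_min_degree_bound[OF sys' ne _ X(1)])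
            fix v assume "v \<notin> X"
            have "card {T\<in>\<B>'. v \<in> T} \<le> card {T\<in>\<B>. v \<in> T}" using D(2) sub by (intro card_mono) auto
            then show "card {T\<in>\<B>'. v \<in> T} \<le> (4 * j + 2) * (c choose (j - 1))"
              using X(3)[OF \<open>v \<notin> X\<close>] by simp
          next
            fix T assume "T \<in> \<B>'"
            then show "Suc d \<le> card {S\<in>\<A>'. T \<subseteq> S}" using deg by (simp add: Suc_le_eq)
          qed (use sub False in auto)
          then show False using counts(2) by simp
        qed
        then show ?thesis unfolding reducible_def by blast
      qed
    qed
  qed
qed

section \<open>The two inductions on \<open>card \<B>\<close>\<close>

lemma part_sys_weak_bound:
  assumes j: "0 < j"
  shows "\<exists>l. \<forall>r \<A> \<B>. Suc j \<le> r \<longrightarrow> part_sys r (Suc j) \<A> \<B> \<longrightarrow> card \<A> \<le> kk j (card \<B>) + l * card \<B>"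
proof -
  obtain M N where red: "\<And>r \<A> \<B>. Suc j \<le> r \<Longrightarrow> part_sys r (Suc j) \<A> \<B> \<Longrightarrow> M \<le> card \<B> \<Longrightarrow>
    reducible j 0 N r \<A> \<B>"
    using part_sys_reducible[OF j, of 0] by blast
  have sq: "card \<A> \<le> card \<B> * card \<B>" if "part_sys r (Suc j) \<A> \<B>" for r \<A> \<B>
    using part_sys_card_le_square[OF that] j by simp
  have "card \<A> \<le> kk j (card \<B>) + (M + N + 1) * card \<B>"
    if "Suc j \<le> r" "part_sys r (Suc j) \<A> \<B>" for r \<A> \<B>
    using that(2)
  proof (induction "card \<B>" arbitrary: \<A> \<B> rule: less_induct)
    case less
    show ?case
    proof (cases "M \<le> card \<B>")
      case False
      then have "card \<B> * card \<B> \<le> (M + N + 1) * card \<B>" by (intro mult_le_mono1) simp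
      then show ?thesis using sq[OF less.prems] by linarith
    next
      case True
      from red[OF that(1) less.prems True, unfolded reducible_def] consider
        (1) "card \<A> \<le> kk j (card \<B>)"
        | (2) \<A>0 \<A>1 \<B>0 \<B>1 where "part_sys r (Suc j) \<A>0 \<B>0" "part_sys r (Suc j) \<A>1 \<B>1"
          "card \<B> = card \<B>0 + card \<B>1" "0 < card \<B>0" "0 < card \<B>1"
          "card \<A> \<le> card \<A>0 + card \<A>1 + card \<B>1" "gain_split j 0 (card \<B>0) (card \<B>1)"
        | (3) \<A>1 \<B>1 where "part_sys r (Suc j) \<A>1 \<B>1" "card \<B>1 < N" "card \<B>1 \<le> card \<B>"
          "card \<A> \<le> kk j (card \<B>) + card \<A>1 + card \<B>1" by blast
      then show ?thesis
      proof cases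
        case 1
        then show ?thesis by simp
      next
        case 2
        have "card \<A>0 \<le> kk j (card \<B>0) + (M + N + 1) * card \<B>0"
          "card \<A>1 \<le> kk j (card \<B>1) + (M + N + 1) * card \<B>1" using 2 by (intro less.hyps; simp)+
        moreover have "kk j (card \<B>0) + kk j (card \<B>1) + card \<B>1 \<le> kk j (card \<B>)"
          using 2 by (simp add: gain_split_def)
        \<comment> \<open>A linear error is additive over a split, so a gain with
          \<open>l = 0\<close> suffices.\<close>
        moreover have "(M + N + 1) * card \<B> = (M + N + 1) * card \<B>0 + (M + N + 1) * card \<B>1"
          using 2(3) by (simp only: distrib_left)
        ultimately show ?thesis using 2(6) by linarith
      next
        case 3
        have "card \<A>1 + card \<B>1 \<le> (card \<B>1 + 1) * card \<B>1" using sq[OF 3(1)] by simp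
        also have "\<dots> \<le> (M + N + 1) * card \<B>" using 3 by (intro mult_le_mono) auto
        finally show ?thesis using 3(4) by linarith
      qed
    qed
  qed
  then show ?thesis by blast
qed

lemma part_sys_bound:
  assumes j: "0 < j"
  shows "\<exists>t. \<forall>r \<A> \<B>. Suc j \<le> r \<longrightarrow> part_sys r (Suc j) \<A> \<B> \<longrightarrow> card \<A> \<le> kk j (card \<B>) + t"
proof -
  obtain l where weak: "\<And>r \<A> \<B>. Suc j \<le> r \<Longrightarrow> part_sys r (Suc j) \<A> \<B> \<Longrightarrow> card \<A> \<le> kk j (card \<B>) + l * card \<B>"
    using part_sys_weak_bound[OF j] by blast
  obtain M N where red: "\<And>r \<A> \<B>. Suc j \<le> r \<Longrightarrow> part_sys r (Suc j) \<A> \<B> \<Longrightarrow> M \<le> card \<B> \<Longrightarrow>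
    reducible j l N r \<A> \<B>"
    using part_sys_reducible[OF j, of l] by blast
  have sq: "card \<A> \<le> card \<B> * card \<B>" if "part_sys r (Suc j) \<A> \<B>" for r \<A> \<B>
    using part_sys_card_le_square[OF that] j by simp
  have "card \<A> \<le> kk j (card \<B>) + (M * M + N * N + N)"
    if r: "Suc j \<le> r" "part_sys r (Suc j) \<A> \<B>" for r \<A> \<B>
    using that(2)
  proof (induction "card \<B>" arbitrary: \<A> \<B> rule: less_induct)
    case less
    show ?case
    proof (cases "M \<le> card \<B>")
      case False
      then have "card \<B> * card \<B> \<le> M * M" by (intro mult_le_mono) auto
      then show ?thesis using sq[OF less.prems] by linarith
    next
      case True
      from red[OF that(1) less.prems True, unfolded reducible_def] consider
        (1) "card \<A> \<le> kk j (card \<B>)"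
        | (2) \<A>0 \<A>1 \<B>0 \<B>1 where "part_sys r (Suc j) \<A>0 \<B>0" "part_sys r (Suc j) \<A>1 \<B>1"
          "card \<B> = card \<B>0 + card \<B>1" "0 < card \<B>0" "0 < card \<B>1"
          "card \<A> \<le> card \<A>0 + card \<A>1 + card \<B>1" "gain_split j l (card \<B>0) (card \<B>1)"
        | (3) \<A>1 \<B>1 where "part_sys r (Suc j) \<A>1 \<B>1" "card \<B>1 < N" "card \<B>1 \<le> card \<B>"
          "card \<A> \<le> kk j (card \<B>) + card \<A>1 + card \<B>1" by blast
      then show ?thesis
      proof cases
        case 1
        then show ?thesis by simp
      next
        case 2
        have "card \<A>0 \<le> kk j (card \<B>0) + (M * M + N * N + N)"
          "card \<A>1 \<le> kk j (card \<B>1) + (M * M + N * N + N)" using 2 by (intro less.hyps; simp)+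
        moreover have "card \<A>0 \<le> kk j (card \<B>0) + l * card \<B>0" "card \<A>1 \<le> kk j (card \<B>1) + l * card \<B>1"
          using weak[OF r(1)] 2 by blast+
        moreover have "kk j (card \<B>0) + kk j (card \<B>1) + card \<B>1 + l * min (card \<B>0) (card \<B>1) \<le> kk j (card \<B>)"
          using 2 by (simp add: gain_split_def)
        \<comment> \<open>The part attaining the minimum uses the weak bound, whose error the gain
          cancels; the other uses the induction hypothesis. The constant is thus charged only
          once.\<close>
        moreover have "l * min (card \<B>0) (card \<B>1) = l * card \<B>0 \<or> l * min (card \<B>0) (card \<B>1) = l * card \<B>1"
          by (simp add: min_def)
        ultimately show ?thesis using 2(6) by linarith
      next
        case 3
        have "card \<B>1 * card \<B>1 \<le> N * N" using 3 by (intro mult_le_mono) auto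
        then have "card \<A>1 + card \<B>1 \<le> M * M + N * N + N" using sq[OF 3(1)] 3(2) by linarith
        then show ?thesis using 3(4) by linarith
      qed
    qed
  qed
  then show ?thesis by blast
qed

section \<open>The lower bound and the passage to \<open>f_max\<close>\<close>

lemma casc_part_sys_exists:
  assumes e: "mono e" and r: "Suc j \<le> r"
  shows "\<exists>\<A> \<B>. part_sys r (Suc j) \<A> \<B> \<and> card \<B> = casc j e \<and> card \<A> = casc_up j e"
proof -
  obtain \<A> \<B> where sys: "shadow_sys j \<A> \<B>" and cB: "card \<B> = casc j e"
    and cA: "card \<A> = casc_up j e" and sub: "\<forall>S\<in>\<A> \<union> \<B>. S \<subseteq> {..<j + e j}"
    and cj: "\<forall>S\<in>\<B>. card S = j"
    using casc_family[OF e, of j] by (elim exE conjE)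
  have fin: "finite \<A>" "finite \<B>" using sys by (auto simp: shadow_sys_def)
  \<comment> \<open>Adjoining these new vertices to every set raises the sizes to \<open>r\<close>
    and \<open>r - 1\<close> and preserves containments.\<close>
  define X where "X = {j + e j..<j + e j + (r - Suc j)}"
  have X: "finite X" "card X = r - Suc j" by (auto simp: X_def)
  have disj: "S \<inter> X = {}" "finite S" if "S \<in> \<A> \<union> \<B>" for S
    using bspec[OF sub that] finite_subset[of S "{..<j + e j}"] by (auto simp: X_def)
  have inj: "inj_on (\<lambda>S. S \<union> X) (\<A> \<union> \<B>)"
    by (rule inj_on_inverseI[where g = "\<lambda>S. S - X"]) (use disj in blast)
  have "part_sys r (Suc j) ((\<lambda>S. S \<union> X) ` \<A>) ((\<lambda>S. S \<union> X) ` \<B>)"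
    unfolding part_sys_def
  proof (intro conjI ballI subsetI)
    fix S assume "S \<in> (\<lambda>S. S \<union> X) ` \<A>"
    then obtain R where R: "R \<in> \<A>" "S = R \<union> X" by blast
    have R': "finite R" "card R = Suc j" "\<And>x. x \<in> R \<Longrightarrow> R - {x} \<in> \<B>" "R \<inter> X = {}"
      using sys R(1) disj[of R] by (auto simp: shadow_sys_def)
    show "S \<in> nsets_nat r" using R R' X r by (simp add: nsets_nat_def card_Un_disjoint)
    have "inj_on (\<lambda>x. (R - {x}) \<union> X) R"
    proof (rule inj_onI)
      fix x y assume "x \<in> R" "y \<in> R" "R - {x} \<union> X = R - {y} \<union> X"
      then show "x = y" using R'(4) by blast
    qed
    moreover have "(\<lambda>x. (R - {x}) \<union> X) ` R \<subseteq> {T \<in> (\<lambda>S. S \<union> X) ` \<B>. T \<subseteq> S}" using R R'(3) by blast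
    ultimately show "Suc j \<le> card {T \<in> (\<lambda>S. S \<union> X) ` \<B>. T \<subseteq> S}"
      using card_inj_on_le[of "\<lambda>x. (R - {x}) \<union> X" R] R'(2) fin by simp
  next
    fix S assume "S \<in> (\<lambda>S. S \<union> X) ` \<B>"
    then obtain R where R: "R \<in> \<B>" "S = R \<union> X" by blast
    then show "S \<in> nsets_nat (r - 1)"
      using disj[of R] cj X r by (simp add: nsets_nat_def card_Un_disjoint)
  qed (use fin in auto)
  moreover have "card ((\<lambda>S. S \<union> X) ` \<A>) = casc_up j e" "card ((\<lambda>S. S \<union> X) ` \<B>) = casc j e"
    using inj cA cB by (simp_all add: card_image inj_on_Un)
  ultimately show ?thesis by blast
qed

lemma casc_of_increasing:
  fixes c :: "nat \<Rightarrow> nat"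
  assumes inc: "\<forall>i. 1 \<le> i \<longrightarrow> i < j \<longrightarrow> c i < c (i + 1)"
  obtains e where "mono e" "casc j e = (\<Sum>i=1..j. c i choose i)" "casc_up j e = (\<Sum>i=1..j. c i choose (i + 1))"
proof -
  have ge: "i \<le> c (Suc i)" if "i < j" for i
    using that
  proof (induction i)
    case (Suc i)
    then show ?case using inc[rule_format, of "Suc i"] by simp
  qed simp
  \<comment> \<open>The minimum freezes \<open>e\<close> after the last given entry, making it
    monotone everywhere; \<open>ge\<close> makes the subtraction exact.\<close>
  define e where "e i = c (Suc (min i (j - 1))) - min i (j - 1)" for i
  have "e i \<le> e (Suc i)" for i
  proof (cases "Suc i < j")
    case True
    then have "c (Suc i) - i \<le> c (Suc (Suc i)) - Suc i" using inc[rule_format, of "Suc i"] by simp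
    then show ?thesis using True by (simp add: e_def min_def)
  next
    case False
    then have "min (Suc i) (j - 1) = min i (j - 1)" by auto
    then show ?thesis by (simp add: e_def)
  qed
  then have "mono e" by (simp add: mono_iff_le_Suc)
  moreover have ie: "i + e i = c (Suc i)" if "i < j" for i
  proof -
    have "min i (j - 1) = i" using that by simp
    then show ?thesis using ge[OF that] by (simp add: e_def)
  qed
  have "casc j e = (\<Sum>i<j. c (Suc i) choose Suc i)" unfolding casc_def using ie by (intro sum.cong) auto
  then have "casc j e = (\<Sum>i=1..j. c i choose i)" by (simp add: sum.atLeast1_atMost_eq lessThan_atLeast0)
  moreover have "casc_up j e = (\<Sum>i<j. c (Suc i) choose Suc (Suc i))"
    unfolding casc_up_def using ie by (intro sum.cong) auto
  then have "casc_up j e = (\<Sum>i=1..j. c i choose (i + 1))" by (simp add: sum.atLeast1_atMost_eq lessThan_atLeast0)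
  ultimately show ?thesis by (rule that)
qed

text \<open>For finite \<open>\<B>\<close>, \<open>k\<close> distinct members inside
  \<open>A\<close> can be chosen exactly when at least \<open>k\<close> members lie inside
  \<open>A\<close>.\<close>

lemma f_max_altdef:
  "f_max r k b = Sup {enat (card \<A>) | \<A> \<B>. part_sys r k \<A> \<B> \<and> card \<B> = b}"
proof -
  have *: "(\<exists>S. S \<subseteq> \<B> \<and> card S = k \<and> (\<forall>X\<in>S. X \<subseteq> A)) \<longleftrightarrow> k \<le> card {T\<in>\<B>. T \<subseteq> A}"
    if "finite \<B>" for A and \<B> :: "nat set set"
  proof
    assume "\<exists>S. S \<subseteq> \<B> \<and> card S = k \<and> (\<forall>X\<in>S. X \<subseteq> A)"
    then obtain S where "S \<subseteq> {T\<in>\<B>. T \<subseteq> A}" "card S = k" by blast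
    then show "k \<le> card {T\<in>\<B>. T \<subseteq> A}" using that card_mono[of "{T\<in>\<B>. T \<subseteq> A}" S] by simp
  next
    assume "k \<le> card {T\<in>\<B>. T \<subseteq> A}"
    then obtain S where "S \<subseteq> {T\<in>\<B>. T \<subseteq> A}" "card S = k" by (meson obtain_subset_with_card_n)
    then show "\<exists>S. S \<subseteq> \<B> \<and> card S = k \<and> (\<forall>X\<in>S. X \<subseteq> A)" by blast
  qed
  have "(finite \<A> \<and> \<A> \<subseteq> nsets_nat r \<and> \<B> \<subseteq> nsets_nat (r - 1) \<and> finite \<B> \<and> card \<B> = b \<and>
      (\<forall>A\<in>\<A>. \<exists>S. S \<subseteq> \<B> \<and> card S = k \<and> (\<forall>X\<in>S. X \<subseteq> A))) \<longleftrightarrow> part_sys r k \<A> \<B> \<and> card \<B> = b" for \<A> \<B>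
    by (cases "finite \<B>") (simp_all add: part_sys_def * conj_ac)
  then show ?thesis unfolding f_max_def by simp
qed

theorem theorem3:
  fixes k :: nat
  assumes "1 \<le> k"
  shows "\<exists>\<tau>::nat. \<forall>r c. k \<le> r \<longrightarrow>
           (\<forall>i. 1 \<le> i \<longrightarrow> i < k - 1 \<longrightarrow> c i < c (i + 1)) \<longrightarrow>
           enat (\<Sum>i=1..k-1. c i choose (i + 1))
             \<le> f_max r k (\<Sum>i=1..k-1. c i choose i) \<and>
           f_max r k (\<Sum>i=1..k-1. c i choose i)
             \<le> enat ((\<Sum>i=1..k-1. c i choose (i + 1)) + \<tau>)"
proof -
  obtain j where k: "k = Suc j" using assms by (cases k) auto
  have "\<exists>t. \<forall>r \<A> \<B> e. Suc j \<le> r \<longrightarrow> mono e \<longrightarrow> part_sys r (Suc j) \<A> \<B> \<longrightarrow> card \<B> = casc j e \<longrightarrow>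
     card \<A> \<le> casc_up j e + t"
  \<comment> \<open>For \<open>k = 1\<close> the cascade is empty, which forces both families to be
    empty; \<open>kk\<close> is meaningful only for positive \<open>j\<close>.\<close>
  proof (cases "j = 0")
    case True
    have "\<A> = {}" if "part_sys r (Suc j) \<A> \<B>" "card \<B> = casc j e" for r \<A> \<B> e
    proof -
      have "\<B> = {}" using that part_sysD(2)[OF that(1)] True by (simp add: casc_def)
      then show ?thesis using part_sysD(7)[OF that(1)] by fastforce
    qed
    then show ?thesis by (metis card.empty zero_le)
  next
    case False
    then show ?thesis using part_sys_bound[of j] kk_casc by (metis neq0_conv)
  qed
  then obtain t where t: "\<And>r \<A> \<B> e. Suc j \<le> r \<Longrightarrow> mono e \<Longrightarrow> part_sys r (Suc j) \<A> \<B> \<Longrightarrow>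
     card \<B> = casc j e \<Longrightarrow> card \<A> \<le> casc_up j e + t" by blast
  show ?thesis
  proof (intro exI[of _ t] allI impI)
    fix r and c :: "nat \<Rightarrow> nat"
    assume r: "k \<le> r" and "\<forall>i. 1 \<le> i \<longrightarrow> i < k - 1 \<longrightarrow> c i < c (i + 1)"
    then have "\<forall>i. 1 \<le> i \<longrightarrow> i < j \<longrightarrow> c i < c (i + 1)" by (simp add: k)
    then obtain e where e: "mono e" "casc j e = (\<Sum>i=1..j. c i choose i)"
      "casc_up j e = (\<Sum>i=1..j. c i choose (i + 1))" by (rule casc_of_increasing)
    have low: "enat (casc_up j e) \<le> f_max r k (casc j e)"
    proof -
      obtain \<A> \<B> where "part_sys r k \<A> \<B>" "card \<B> = casc j e" "card \<A> = casc_up j e"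
        using casc_part_sys_exists[OF e(1), of j r] r k by auto
      then show ?thesis unfolding f_max_altdef
        by (intro Sup_upper) force
    qed
    have up: "f_max r k (casc j e) \<le> enat (casc_up j e + t)"
      unfolding f_max_altdef
      by (rule Sup_least) (use t[OF _ e(1)] r k in auto)
    show "enat (\<Sum>i=1..k-1. c i choose (i + 1)) \<le> f_max r k (\<Sum>i=1..k-1. c i choose i) \<and>
           f_max r k (\<Sum>i=1..k-1. c i choose i) \<le> enat ((\<Sum>i=1..k-1. c i choose (i + 1)) + t)"
      using low up e by (simp add: k)
  qed
qed

end
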